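(* Let $K$ be a field. Let $\mathbb A$ be a functor of $\mathcal K$-algebras which is a D-proquasi-coherent module, let $M$ and $N$ be $K$-vector spaces whose associated quasi-coherent modules $\mathcal M$ and $\mathcal N$ are functors of $\mathbb A$-modules, and let $M'\subset M$ be a $K$-vector subspace with associated quasi-coherent module $\mathcal M'$. Then: (1) $\mathcal M'$ is a quasi-coherent $\mathbb A$-submodule of $\mathcal M$ if and only if $M'$ is an $\mathbb A(K)$-submodule of $M$. (2) A morphism $f\colon\mathcal M\to\mathcal N$ of functors of $\mathcal K$-modules is a morphism of $\mathbb A$-modules if and only if $f_K\colon M\to N$ is a morphism of $\mathbb A(K)$-modules.
   Context: $K$ is a field. All functors are covariant functors on the category of commutative $K$-algebras. $\mathcal K$ is the functor of rings $\mathcal K(S)=S$. A functor of $\mathcal K$-modules $\mathbb M$ is a functor of sets with morphisms of functors $\mathbb M\times\mathbb M\to\mathbb M$, $\mathcal K\times\mathbb M\to\mathbb M$ making $\mathbb M(S)$ an $S$-module for every commutative $K$-algebra $S$. A morphism is a natural transformation $f$ with every $f_S$ $S$-linear. A functor of $\mathcal K$-algebras is a functor $\mathbb A$ of (associative unital, not necessarily commutative) rings with a morphism of functors of rings $\mathcal K\to\mathbb A$ such that $S$ is central in $\mathbb A(S)$ for every $S$. Functors of $\mathbb A$-modules are functors of $\mathcal K$-modules with a compatible (pointwise) $\mathbb A(S)$-module structure, functorial in $S$. For a $K$-vector space $V$, the associated quasi-coherent module is $\mathcal V(S)=V\otimes_K S$. $\mathbb M^*(S):=\operatorname{Hom}_{\mathcal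 S}(\mathbb M_{|S},\mathcal S)$, where $\mathbb M_{|S}$ is the restriction of $\mathbb M$ to commutative $S$-algebras and $\mathcal S(T)=T$. $\mathbb M(\mathcal K)$ denotes the functor $S\mapsto\mathbb M(K)\otimes_K S$, with natural morphism $\mathbb M(\mathcal K)\to\mathbb M$, $m\otimes s\mapsto s\cdot m$. $\mathbb M$ is D-proquasi-coherent if the dual morphism $\mathbb M^*\to\mathbb M(\mathcal K)^*$ is injective (on every $S$). *)

theory Defs
  imports "HOL-Algebra.Module" "HOL-Algebra.Coset" "HOL-Algebra.Generated_Groups"
    "HOL-Algebra.Free_Abelian_Groups"
begin

section \<open>The category of commutative algebras\<close>

text \<open>
  A commutative algebra over a commutative ring R is a record S with \<open>algebra R S\<close>.  The
  category of all commutative K-algebras is taken relative to a universe: the (arbitrary) type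
  \<open>'u\<close>, in which K and the carriers of all the algebras live.
\<close>

type_synonym 'u calg = "('u, 'u) module"

text \<open>Morphisms are extensional, so that two of them are equal as soon as they agree on the carrier.\<close>

definition alg_hom :: "('u, 'r) ring_scheme \<Rightarrow> 'u calg \<Rightarrow> 'u calg \<Rightarrow> ('u \<Rightarrow> 'u) set" where
  "alg_hom R S T = {\<phi> \<in> ring_hom S T. \<phi> \<in> extensional (carrier S) \<and>
     (\<forall>r\<in>carrier R. \<forall>s\<in>carrier S. \<phi> (r \<odot>\<^bsub>S\<^esub> s) = r \<odot>\<^bsub>T\<^esub> \<phi> s)}"

definition self_alg :: "'u ring \<Rightarrow> 'u calg" where
  "self_alg K = ring.extend K (module.fields (\<lambda>r x. r \<otimes>\<^bsub>K\<^esub> x))"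

definition struct_map :: "('u, 'r) ring_scheme \<Rightarrow> 'u calg \<Rightarrow> 'u \<Rightarrow> 'u" where
  "struct_map R S = (\<lambda>r\<in>carrier R. r \<odot>\<^bsub>S\<^esub> \<one>\<^bsub>S\<^esub>)"

text \<open>An S-algebra T, viewed as a K-algebra through \<open>K \<rightarrow> S \<rightarrow> T\<close>.\<close>

definition restrict_scalars :: "'u calg \<Rightarrow> 'u calg \<Rightarrow> 'u calg" where
  "restrict_scalars S T = T\<lparr>smult := \<lambda>k t. (k \<odot>\<^bsub>S\<^esub> \<one>\<^bsub>S\<^esub>) \<odot>\<^bsub>T\<^esub> t\<rparr>"


section \<open>Functors of modules and of algebras\<close>

text \<open>
  Only the values of these functors on K-algebras, K-algebra morphisms and elements of carriers
  are meaningful.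
\<close>

record ('u, 'x) mod_functor =
  fobj :: "'u calg \<Rightarrow> ('u, 'x) module"
  fmap :: "'u calg \<Rightarrow> 'u calg \<Rightarrow> ('u \<Rightarrow> 'u) \<Rightarrow> 'x \<Rightarrow> 'x"

definition K_module_functor :: "'u ring \<Rightarrow> ('u, 'x) mod_functor \<Rightarrow> bool" where
  "K_module_functor K F \<longleftrightarrow>
     (\<forall>S. algebra K S \<longrightarrow> module S (fobj F S)) \<and>
     (\<forall>S T \<phi>. algebra K S \<longrightarrow> algebra K T \<longrightarrow> \<phi> \<in> alg_hom K S T \<longrightarrow>
        fmap F S T \<phi> \<in> carrier (fobj F S) \<rightarrow> carrier (fobj F T) \<and>
        (\<forall>x\<in>carrier (fobj F S). \<forall>y\<in>carrier (fobj F S).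
           fmap F S T \<phi> (x \<oplus>\<^bsub>fobj F S\<^esub> y) = fmap F S T \<phi> x \<oplus>\<^bsub>fobj F T\<^esub> fmap F S T \<phi> y) \<and>
        (\<forall>s\<in>carrier S. \<forall>x\<in>carrier (fobj F S).
           fmap F S T \<phi> (s \<odot>\<^bsub>fobj F S\<^esub> x) = \<phi> s \<odot>\<^bsub>fobj F T\<^esub> fmap F S T \<phi> x)) \<and>
     (\<forall>S. algebra K S \<longrightarrow> (\<forall>x\<in>carrier (fobj F S). fmap F S S (\<lambda>s\<in>carrier S. s) x = x)) \<and>
     (\<forall>S T U \<phi> \<psi>. algebra K S \<longrightarrow> algebra K T \<longrightarrow> algebra K U \<longrightarrow>
        \<phi> \<in> alg_hom K S T \<longrightarrow> \<psi> \<in> alg_hom K T U \<longrightarrow>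
        (\<forall>x\<in>carrier (fobj F S).
           fmap F S U (compose (carrier S) \<psi> \<phi>) x = fmap F T U \<psi> (fmap F S T \<phi> x)))"

definition K_module_morphism ::
  "'u ring \<Rightarrow> ('u, 'x) mod_functor \<Rightarrow> ('u, 'y) mod_functor \<Rightarrow> ('u calg \<Rightarrow> 'x \<Rightarrow> 'y) \<Rightarrow> bool" where
  "K_module_morphism K F G f \<longleftrightarrow>
     (\<forall>S. algebra K S \<longrightarrow>
        f S \<in> carrier (fobj F S) \<rightarrow> carrier (fobj G S) \<and>
        (\<forall>x\<in>carrier (fobj F S). \<forall>y\<in>carrier (fobj F S).
           f S (x \<oplus>\<^bsub>fobj F S\<^esub> y) = f S x \<oplus>\<^bsub>fobj G S\<^esub> f S y) \<and>
        (\<forall>s\<in>carrier S. \<forall>x\<in>carrier (fobj F S).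
           f S (s \<odot>\<^bsub>fobj F S\<^esub> x) = s \<odot>\<^bsub>fobj G S\<^esub> f S x)) \<and>
     (\<forall>S T \<phi>. algebra K S \<longrightarrow> algebra K T \<longrightarrow> \<phi> \<in> alg_hom K S T \<longrightarrow>
        (\<forall>x\<in>carrier (fobj F S). f T (fmap F S T \<phi> x) = fmap G S T \<phi> (f S x)))"

record ('u, 'a) alg_functor =
  aobj :: "'u calg \<Rightarrow> 'a ring"
  amap :: "'u calg \<Rightarrow> 'u calg \<Rightarrow> ('u \<Rightarrow> 'u) \<Rightarrow> 'a \<Rightarrow> 'a"
  aunit :: "'u calg \<Rightarrow> 'u \<Rightarrow> 'a"

definition K_algebra_functor :: "'u ring \<Rightarrow> ('u, 'a) alg_functor \<Rightarrow> bool" where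
  "K_algebra_functor K A \<longleftrightarrow>
     (\<forall>S. algebra K S \<longrightarrow> ring (aobj A S)) \<and>
     (\<forall>S T \<phi>. algebra K S \<longrightarrow> algebra K T \<longrightarrow> \<phi> \<in> alg_hom K S T \<longrightarrow>
        amap A S T \<phi> \<in> ring_hom (aobj A S) (aobj A T)) \<and>
     (\<forall>S. algebra K S \<longrightarrow> (\<forall>a\<in>carrier (aobj A S). amap A S S (\<lambda>s\<in>carrier S. s) a = a)) \<and>
     (\<forall>S T U \<phi> \<psi>. algebra K S \<longrightarrow> algebra K T \<longrightarrow> algebra K U \<longrightarrow>
        \<phi> \<in> alg_hom K S T \<longrightarrow> \<psi> \<in> alg_hom K T U \<longrightarrow>
        (\<forall>a\<in>carrier (aobj A S).
           amap A S U (compose (carrier S) \<psi> \<phi>) a = amap A T U \<psi> (amap A S T \<phi> a))) \<and>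
     (\<forall>S. algebra K S \<longrightarrow> aunit A S \<in> ring_hom S (aobj A S) \<and>
        (\<forall>s\<in>carrier S. \<forall>a\<in>carrier (aobj A S).
           aunit A S s \<otimes>\<^bsub>aobj A S\<^esub> a = a \<otimes>\<^bsub>aobj A S\<^esub> aunit A S s)) \<and>
     (\<forall>S T \<phi>. algebra K S \<longrightarrow> algebra K T \<longrightarrow> \<phi> \<in> alg_hom K S T \<longrightarrow>
        (\<forall>s\<in>carrier S. amap A S T \<phi> (aunit A S s) = aunit A T (\<phi> s)))"

definition underlying_module :: "('u, 'a) alg_functor \<Rightarrow> ('u, 'a) mod_functor" where
  "underlying_module A =
     \<lparr>fobj = (\<lambda>S. ring.extend (aobj A S)
                (module.fields (\<lambda>s a. aunit A S s \<otimes>\<^bsub>aobj A S\<^esub> a))),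
      fmap = amap A\<rparr>"


section \<open>Modules over not necessarily commutative rings\<close>

definition left_module ::
  "('a, 'r) ring_scheme \<Rightarrow> ('x, 'm) ring_scheme \<Rightarrow> ('a \<Rightarrow> 'x \<Rightarrow> 'x) \<Rightarrow> bool" where
  "left_module R X act \<longleftrightarrow> ring R \<and> abelian_group X \<and>
     (\<forall>a\<in>carrier R. \<forall>x\<in>carrier X. act a x \<in> carrier X) \<and>
     (\<forall>a\<in>carrier R. \<forall>b\<in>carrier R. \<forall>x\<in>carrier X.
        act (a \<oplus>\<^bsub>R\<^esub> b) x = act a x \<oplus>\<^bsub>X\<^esub> act b x) \<and>
     (\<forall>a\<in>carrier R. \<forall>x\<in>carrier X. \<forall>y\<in>carrier X.
        act a (x \<oplus>\<^bsub>X\<^esub> y) = act a x \<oplus>\<^bsub>X\<^esub> act a y) \<and>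
     (\<forall>a\<in>carrier R. \<forall>b\<in>carrier R. \<forall>x\<in>carrier X.
        act (a \<otimes>\<^bsub>R\<^esub> b) x = act a (act b x)) \<and>
     (\<forall>x\<in>carrier X. act \<one>\<^bsub>R\<^esub> x = x)"

definition left_submodule ::
  "('a, 'r) ring_scheme \<Rightarrow> ('x, 'm) ring_scheme \<Rightarrow> ('a \<Rightarrow> 'x \<Rightarrow> 'x) \<Rightarrow> 'x set \<Rightarrow> bool" where
  "left_submodule R X act H \<longleftrightarrow>
     subgroup H (add_monoid X) \<and> (\<forall>a\<in>carrier R. \<forall>x\<in>H. act a x \<in> H)"

definition left_module_hom ::
  "('a, 'r) ring_scheme \<Rightarrow> ('x, 'm) ring_scheme \<Rightarrow> ('a \<Rightarrow> 'x \<Rightarrow> 'x) \<Rightarrow>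
   ('y, 'n) ring_scheme \<Rightarrow> ('a \<Rightarrow> 'y \<Rightarrow> 'y) \<Rightarrow> ('x \<Rightarrow> 'y) \<Rightarrow> bool" where
  "left_module_hom R X actX Y actY h \<longleftrightarrow>
     h \<in> hom (add_monoid X) (add_monoid Y) \<and>
     (\<forall>a\<in>carrier R. \<forall>x\<in>carrier X. h (actX a x) = actY a (h x))"


section \<open>Functors of modules over a functor of algebras\<close>

text \<open>The action \<open>act S\<close> of the ring \<open>\<A>(S)\<close> on \<open>\<F>(S)\<close> is extra data on the functor of K-modules F.\<close>

definition A_module_functor ::
  "'u ring \<Rightarrow> ('u, 'a) alg_functor \<Rightarrow> ('u, 'x) mod_functor \<Rightarrow> ('u calg \<Rightarrow> 'a \<Rightarrow> 'x \<Rightarrow> 'x) \<Rightarrow> bool" where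
  "A_module_functor K A F act \<longleftrightarrow> K_module_functor K F \<and>
     (\<forall>S. algebra K S \<longrightarrow> left_module (aobj A S) (fobj F S) (act S) \<and>
        (\<forall>s\<in>carrier S. \<forall>x\<in>carrier (fobj F S). act S (aunit A S s) x = s \<odot>\<^bsub>fobj F S\<^esub> x)) \<and>
     (\<forall>S T \<phi>. algebra K S \<longrightarrow> algebra K T \<longrightarrow> \<phi> \<in> alg_hom K S T \<longrightarrow>
        (\<forall>a\<in>carrier (aobj A S). \<forall>x\<in>carrier (fobj F S).
           fmap F S T \<phi> (act S a x) = act T (amap A S T \<phi> a) (fmap F S T \<phi> x)))"

definition A_module_morphism ::
  "'u ring \<Rightarrow> ('u, 'a) alg_functor \<Rightarrow>
   ('u, 'x) mod_functor \<Rightarrow> ('u calg \<Rightarrow> 'a \<Rightarrow> 'x \<Rightarrow> 'x) \<Rightarrow>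
   ('u, 'y) mod_functor \<Rightarrow> ('u calg \<Rightarrow> 'a \<Rightarrow> 'y \<Rightarrow> 'y) \<Rightarrow> ('u calg \<Rightarrow> 'x \<Rightarrow> 'y) \<Rightarrow> bool" where
  "A_module_morphism K A F actF G actG f \<longleftrightarrow> K_module_morphism K F G f \<and>
     (\<forall>S. algebra K S \<longrightarrow>
        left_module_hom (aobj A S) (fobj F S) (actF S) (fobj G S) (actG S) (f S))"

text \<open>The functor of K-modules L is a submodule of F over A, by means of the inclusion \<open>\<iota>\<close>.\<close>

definition A_submodule_functor ::
  "'u ring \<Rightarrow> ('u, 'a) alg_functor \<Rightarrow> ('u, 'x) mod_functor \<Rightarrow> ('u calg \<Rightarrow> 'a \<Rightarrow> 'x \<Rightarrow> 'x) \<Rightarrow>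
   ('u, 'y) mod_functor \<Rightarrow> ('u calg \<Rightarrow> 'y \<Rightarrow> 'x) \<Rightarrow> bool" where
  "A_submodule_functor K A F act L \<iota> \<longleftrightarrow>
     K_module_functor K L \<and> K_module_morphism K L F \<iota> \<and>
     (\<forall>S. algebra K S \<longrightarrow> inj_on (\<iota> S) (carrier (fobj L S)) \<and>
        left_submodule (aobj A S) (fobj F S) (act S) (\<iota> S ` carrier (fobj L S)))"


section \<open>Tensor products and quasi-coherent modules\<close>

text \<open>
  The tensor product of a K-module V and a commutative K-algebra S is the quotient of the free
  abelian group on pairs by the usual relations; its elements are cosets.
\<close>

type_synonym ('v, 'u) tensor = "(('v \<times> 'u) \<Rightarrow>\<^sub>0 int) set"

definition tensor_relators ::
  "'u ring \<Rightarrow> ('u, 'v) module \<Rightarrow> 'u calg \<Rightarrow> (('v \<times> 'u) \<Rightarrow>\<^sub>0 int) set" where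
  "tensor_relators K V S =
     {frag_of (v \<oplus>\<^bsub>V\<^esub> w, s) - frag_of (v, s) - frag_of (w, s) | v w s.
        v \<in> carrier V \<and> w \<in> carrier V \<and> s \<in> carrier S} \<union>
     {frag_of (v, s \<oplus>\<^bsub>S\<^esub> t) - frag_of (v, s) - frag_of (v, t) | v s t.
        v \<in> carrier V \<and> s \<in> carrier S \<and> t \<in> carrier S} \<union>
     {frag_of (k \<odot>\<^bsub>V\<^esub> v, s) - frag_of (v, k \<odot>\<^bsub>S\<^esub> s) | k v s.
        k \<in> carrier K \<and> v \<in> carrier V \<and> s \<in> carrier S}"

definition tensor_kernel ::
  "'u ring \<Rightarrow> ('u, 'v) module \<Rightarrow> 'u calg \<Rightarrow> (('v \<times> 'u) \<Rightarrow>\<^sub>0 int) set" where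
  "tensor_kernel K V S =
     generate (free_Abelian_group (carrier V \<times> carrier S)) (tensor_relators K V S)"

definition tensor_group ::
  "'u ring \<Rightarrow> ('u, 'v) module \<Rightarrow> 'u calg \<Rightarrow> ('v, 'u) tensor monoid" where
  "tensor_group K V S =
     free_Abelian_group (carrier V \<times> carrier S) Mod tensor_kernel K V S"

definition pure_tensor ::
  "'u ring \<Rightarrow> ('u, 'v) module \<Rightarrow> 'u calg \<Rightarrow> 'v \<Rightarrow> 'u \<Rightarrow> ('v, 'u) tensor" where
  "pure_tensor K V S v s =
     tensor_kernel K V S #>\<^bsub>free_Abelian_group (carrier V \<times> carrier S)\<^esub> frag_of (v, s)"

text \<open>
  For a balanced map b into a commutative group G, this is the induced homomorphism
  \<open>v \<otimes> s \<mapsto> b v s\<close>: all the representatives of a coset then yield the same value.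
\<close>

definition tensor_lift :: "('g, 'm) monoid_scheme \<Rightarrow> ('v \<Rightarrow> 'u \<Rightarrow> 'g) \<Rightarrow> ('v, 'u) tensor \<Rightarrow> 'g" where
  "tensor_lift G b X = the_elem ((\<lambda>c. finprod G
     (\<lambda>p. b (fst p) (snd p) [^]\<^bsub>G\<^esub> Poly_Mapping.lookup c p) (Poly_Mapping.keys c)) ` X)"

text \<open>The S-module \<open>V \<otimes> S\<close>; the ring fields \<open>mult\<close> and \<open>one\<close> of the record play no role.\<close>

definition tensor_module ::
  "'u ring \<Rightarrow> ('u, 'v) module \<Rightarrow> 'u calg \<Rightarrow> ('u, ('v, 'u) tensor) module" where
  "tensor_module K V S =
     \<lparr>carrier = carrier (tensor_group K V S), monoid.mult = undefined, one = undefined,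
      ring.zero = \<one>\<^bsub>tensor_group K V S\<^esub>, ring.add = monoid.mult (tensor_group K V S),
      smult = (\<lambda>s. tensor_lift (tensor_group K V S) (\<lambda>v t. pure_tensor K V S v (s \<otimes>\<^bsub>S\<^esub> t)))\<rparr>"

definition quasi_coherent ::
  "'u ring \<Rightarrow> ('u, 'v) module \<Rightarrow> ('u, ('v, 'u) tensor) mod_functor" where
  "quasi_coherent K V =
     \<lparr>fobj = tensor_module K V,
      fmap = (\<lambda>S T \<phi>. tensor_lift (tensor_group K V T) (\<lambda>v s. pure_tensor K V T v (\<phi> s)))\<rparr>"

text \<open>The morphism \<open>v \<otimes> s \<mapsto> v \<otimes> s\<close> of quasi-coherent modules given by a submodule \<open>V'\<close> of V.\<close>

definition qc_inclusion ::
  "'u ring \<Rightarrow> ('u, 'v) module \<Rightarrow> 'u calg \<Rightarrow> ('v, 'u) tensor \<Rightarrow> ('v, 'u) tensor" where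
  "qc_inclusion K V S = tensor_lift (tensor_group K V S) (pure_tensor K V S)"


section \<open>D-proquasi-coherent modules\<close>

text \<open>
  The underlying set of \<open>F\<^sup>*(S)\<close>: S-linear natural families \<open>F(T) \<rightarrow> T\<close>, for T ranging over the
  commutative S-algebras.  Families are extensional, so that equality is the intended one.
\<close>

definition dual_set :: "('u, 'x) mod_functor \<Rightarrow> 'u calg \<Rightarrow> ('u calg \<Rightarrow> 'x \<Rightarrow> 'u) set" where
  "dual_set F S =
     {w. w \<in> (\<Pi>\<^sub>E T \<in> {T. algebra S T}.
               carrier (fobj F (restrict_scalars S T)) \<rightarrow>\<^sub>E carrier T) \<and>
        (\<forall>T. algebra S T \<longrightarrow> (let X = fobj F (restrict_scalars S T) in
           (\<forall>x\<in>carrier X. \<forall>y\<in>carrier X. w T (x \<oplus>\<^bsub>X\<^esub> y) = w T x \<oplus>\<^bsub>T\<^esub> w T y) \<and>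
           (\<forall>t\<in>carrier T. \<forall>x\<in>carrier X. w T (t \<odot>\<^bsub>X\<^esub> x) = t \<otimes>\<^bsub>T\<^esub> w T x))) \<and>
        (\<forall>T U \<phi>. algebra S T \<longrightarrow> algebra S U \<longrightarrow> \<phi> \<in> alg_hom S T U \<longrightarrow>
           (\<forall>x\<in>carrier (fobj F (restrict_scalars S T)).
              w U (fmap F (restrict_scalars S T) (restrict_scalars S U) \<phi> x) = \<phi> (w T x)))}"

definition dual_map ::
  "('u, 'x) mod_functor \<Rightarrow> ('u calg \<Rightarrow> 'x \<Rightarrow> 'y) \<Rightarrow> 'u calg \<Rightarrow>
   ('u calg \<Rightarrow> 'y \<Rightarrow> 'u) \<Rightarrow> ('u calg \<Rightarrow> 'x \<Rightarrow> 'u)" where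
  "dual_map F g S w = (\<lambda>T\<in>{T. algebra S T}.
     \<lambda>x\<in>carrier (fobj F (restrict_scalars S T)). w T (g (restrict_scalars S T) x))"

text \<open>The quasi-coherent module associated with \<open>F(K)\<close>, and its morphism \<open>m \<otimes> s \<mapsto> s \<cdot> m\<close> to F.\<close>

definition qc_of_points :: "'u ring \<Rightarrow> ('u, 'x) mod_functor \<Rightarrow> ('u, ('x, 'u) tensor) mod_functor" where
  "qc_of_points K F = quasi_coherent K (fobj F (self_alg K))"

definition from_points ::
  "'u ring \<Rightarrow> ('u, 'x) mod_functor \<Rightarrow> 'u calg \<Rightarrow> ('x, 'u) tensor \<Rightarrow> 'x" where
  "from_points K F S = tensor_lift (add_monoid (fobj F S))
     (\<lambda>m s. s \<odot>\<^bsub>fobj F S\<^esub> fmap F (self_alg K) S (struct_map K S) m)"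

definition D_proquasi_coherent :: "'u ring \<Rightarrow> ('u, 'x) mod_functor \<Rightarrow> bool" where
  "D_proquasi_coherent K F \<longleftrightarrow> K_module_functor K F \<and>
     (\<forall>S. algebra K S \<longrightarrow>
        inj_on (dual_map (qc_of_points K F) (from_points K F) S) (dual_set F S))"


section \<open>Values at K\<close>

text \<open>
  Transport along the canonical identification \<open>V \<rightarrow> V \<otimes> K\<close>, \<open>v \<mapsto> v \<otimes> 1\<close>, of the action of
  \<open>\<A>(K)\<close> and of the component at K of a morphism.
\<close>

definition point_tensor :: "'u ring \<Rightarrow> ('u, 'v) module \<Rightarrow> 'v \<Rightarrow> ('v, 'u) tensor" where
  "point_tensor K V v = pure_tensor K V (self_alg K) v \<one>\<^bsub>K\<^esub>"

definition point_action ::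
  "'u ring \<Rightarrow> ('u, 'v) module \<Rightarrow> ('u calg \<Rightarrow> 'a \<Rightarrow> ('v, 'u) tensor \<Rightarrow> ('v, 'u) tensor) \<Rightarrow>
   'a \<Rightarrow> 'v \<Rightarrow> 'v" where
  "point_action K V act a v =
     the_inv_into (carrier V) (point_tensor K V) (act (self_alg K) a (point_tensor K V v))"

definition point_map ::
  "'u ring \<Rightarrow> ('u, 'v) module \<Rightarrow> ('u, 'w) module \<Rightarrow>
   ('u calg \<Rightarrow> ('v, 'u) tensor \<Rightarrow> ('w, 'u) tensor) \<Rightarrow> 'v \<Rightarrow> 'w" where
  "point_map K V W f v =
     the_inv_into (carrier W) (point_tensor K W) (f (self_alg K) (point_tensor K V v))"

end

theory Submission
  imports Defs
begin

text \<open>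
  Both parts say that a condition on all \<open>\<A>(S)\<close> can be tested on the single ring \<open>\<A>(K)\<close>.  They
  are instances of one principle.  Let F be D-proquasi-coherent, let V be a vector space with a
  subspace W, and let \<open>h : F \<rightarrow> \<V>\<close> be a morphism of functors of K-modules.  If h maps \<open>F(K)\<close> into W,
  then h maps \<open>F(S)\<close> into \<open>W \<otimes> S\<close> for every S
  (\<open>D_proquasi_coherent_morphism_into_tensor_span\<close>).

  To prove the principle, let l be a linear functional on V that vanishes on W.  The composites
  \<open>F(S) \<rightarrow> V \<otimes> S \<rightarrow> S\<close> of h with \<open>l \<otimes> S\<close> form an element of \<open>F\<^sup>*(K)\<close>.  It vanishes on \<open>F(K)\<close>, hence
  on every multiple \<open>s \<cdot> m\<close> of the image of a point m of \<open>F(K)\<close>, so its image in the dual of the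
  quasi-coherent module of \<open>F(K)\<close> is 0.  By D-proquasi-coherence it is 0 itself.  Thus every
  functional that kills W kills h(a), and over a field such functionals cut out \<open>W \<otimes> S\<close> inside
  \<open>V \<otimes> S\<close> (\<open>tensor_span_separation\<close>).

  For the submodule statement, let F be \<open>\<A>\<close> and take \<open>h(a) = a \<cdot> (m \<otimes> 1)\<close> with m in \<open>M'\<close> and
  \<open>W = M'\<close>.  For the statement on morphisms, take \<open>h(a) = f (a \<cdot> (m \<otimes> 1)) - a \<cdot> f (m \<otimes> 1)\<close> and \<open>W = 0\<close>.  In both cases the
  elements \<open>m \<otimes> 1\<close> suffice because they generate \<open>M \<otimes> S\<close> over S, and S is central in \<open>\<A>(S)\<close>.
  The converse implications evaluate at K, where \<open>V \<otimes> K\<close> is V.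
\<close>

section \<open>The universal property of the tensor product\<close>

text \<open>
  The maps \<open>V \<times> S \<rightarrow> Y\<close> that factor through the tensor product over K.  The target is just an additive
  group: scalars pass from one argument to the other instead of coming out.
\<close>

definition balanced ::
  "'u ring \<Rightarrow> ('u, 'v) module \<Rightarrow> 'u calg \<Rightarrow> ('y, 'm) ring_scheme \<Rightarrow> ('v \<Rightarrow> 'u \<Rightarrow> 'y) \<Rightarrow> bool" where
  "balanced K V S Y b \<longleftrightarrow>
     (\<forall>v\<in>carrier V. \<forall>s\<in>carrier S. b v s \<in> carrier Y) \<and>
     (\<forall>v\<in>carrier V. \<forall>w\<in>carrier V. \<forall>s\<in>carrier S. b (v \<oplus>\<^bsub>V\<^esub> w) s = b v s \<oplus>\<^bsub>Y\<^esub> b w s) \<and>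
     (\<forall>v\<in>carrier V. \<forall>s\<in>carrier S. \<forall>t\<in>carrier S. b v (s \<oplus>\<^bsub>S\<^esub> t) = b v s \<oplus>\<^bsub>Y\<^esub> b v t) \<and>
     (\<forall>k\<in>carrier K. \<forall>v\<in>carrier V. \<forall>s\<in>carrier S. b (k \<odot>\<^bsub>V\<^esub> v) s = b v (k \<odot>\<^bsub>S\<^esub> s))"

text \<open>
  A homomorphism is determined by its values on the generators.  This identifies the explicit
  product in the definition of \<open>tensor_lift\<close> with the homomorphism that the universal property of
  the free abelian group provides.
\<close>

lemma hom_free_Abelian_group_eq_finprod:
  assumes "comm_group G" and h: "h \<in> hom (free_Abelian_group B) G"
    and c: "Poly_Mapping.keys c \<subseteq> B"
  shows "h c = finprod G (\<lambda>p. h (frag_of p) [^]\<^bsub>G\<^esub> Poly_Mapping.lookup c p) (Poly_Mapping.keys c)"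
proof -
  interpret G: comm_group G by fact
  interpret h: group_hom "free_Abelian_group B" G h
    using h by (simp add: group_hom_def group_hom_axioms_def G.is_group)
  let ?n = "Poly_Mapping.lookup c"
  have *: "Poly_Mapping.keys (\<Sum>p\<in>I. frag_cmul (?n p) (frag_of p)) \<subseteq> B \<and>
      h (\<Sum>p\<in>I. frag_cmul (?n p) (frag_of p)) = finprod G (\<lambda>p. h (frag_of p) [^]\<^bsub>G\<^esub> ?n p) I"
    if "finite I" "I \<subseteq> B" for I
    using that
  proof (induction I)
    case empty
    then show ?case
      using h.hom_one by simp
  next
    case (insert x I)
    have x: "frag_of x \<in> carrier (free_Abelian_group B)"
      using insert by simp
    have cl: "Poly_Mapping.keys (frag_cmul (?n x) (frag_of x)) \<subseteq> B"
      using insert.prems keys_cmul[of "?n x" "frag_of x"] by auto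
    have pow: "h (frag_cmul (?n x) (frag_of x)) = h (frag_of x) [^]\<^bsub>G\<^esub> ?n x"
      using h.hom_int_pow[OF x, of "?n x"] insert.prems by simp
    have IH: "Poly_Mapping.keys (\<Sum>p\<in>I. frag_cmul (?n p) (frag_of p)) \<subseteq> B"
      "h (\<Sum>p\<in>I. frag_cmul (?n p) (frag_of p)) = finprod G (\<lambda>p. h (frag_of p) [^]\<^bsub>G\<^esub> ?n p) I"
      using insert by auto
    have "h (frag_cmul (?n x) (frag_of x) + (\<Sum>p\<in>I. frag_cmul (?n p) (frag_of p))) =
        h (frag_of x) [^]\<^bsub>G\<^esub> ?n x \<otimes>\<^bsub>G\<^esub> finprod G (\<lambda>p. h (frag_of p) [^]\<^bsub>G\<^esub> ?n p) I"
      using h.hom_mult[of "frag_cmul (?n x) (frag_of x)"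
          "\<Sum>p\<in>I. frag_cmul (?n p) (frag_of p)"] cl IH pow by simp
    moreover have "h (frag_of p) \<in> carrier G" if "p \<in> insert x I" for p
      using that insert.prems by (intro h.hom_closed) auto
    moreover have "Poly_Mapping.keys
        (frag_cmul (?n x) (frag_of x) + (\<Sum>p\<in>I. frag_cmul (?n p) (frag_of p))) \<subseteq> B"
      by (rule order.trans[OF keys_add Un_least[OF cl IH(1)]])
    ultimately show ?case
      using insert.hyps by (simp add: Pi_def)
  qed
  have "c = (\<Sum>p\<in>Poly_Mapping.keys c. frag_cmul (?n p) (frag_of p))"
    using frag_expansion[of c] by (simp add: frag_extend_def)
  then show ?thesis
    using *[of "Poly_Mapping.keys c"] c by simp
qed

locale tensor_product = V: module K V + S: algebra K S
  for K :: "'u ring" and V :: "('u, 'v) module" and S :: "'u calg"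
begin

abbreviation "X \<equiv> tensor_module K V S"
abbreviation pure (infixl "\<otimes>\<^sub>t" 70) where "v \<otimes>\<^sub>t s \<equiv> pure_tensor K V S v s"
abbreviation "Fr \<equiv> free_Abelian_group (carrier V \<times> carrier S)"
abbreviation "Ker \<equiv> tensor_kernel K V S"

lemma diff_in_Fr: "c \<in> carrier Fr \<Longrightarrow> d \<in> carrier Fr \<Longrightarrow> c - d \<in> carrier Fr"
  using keys_diff[of c d] by auto

lemma frag_of_in: "v \<in> carrier V \<Longrightarrow> s \<in> carrier S \<Longrightarrow> frag_of (v, s) \<in> carrier Fr"
  by simp

lemma relators_closed: "tensor_relators K V S \<subseteq> carrier Fr"
  unfolding tensor_relators_def
  by (intro Un_least subsetI; elim CollectE exE conjE; hypsubst; intro diff_in_Fr frag_of_in) simp_all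

lemma Ker_normal: "Ker \<lhd> Fr"
  unfolding tensor_kernel_def
  by (intro comm_group.subgroup_imp_normal abelian_free_Abelian_group
      group.generate_is_subgroup group_free_Abelian_group relators_closed)

lemma relator_in_Ker: "r \<in> tensor_relators K V S \<Longrightarrow> r \<in> Ker"
  unfolding tensor_kernel_def by (rule generate.incl)

abbreviation cls where "cls c \<equiv> Ker #>\<^bsub>Fr\<^esub> c"

lemma comm_group_tensor_group: "comm_group (tensor_group K V S)"
  unfolding tensor_group_def
  by (intro comm_group.abelian_FactGroup abelian_free_Abelian_group
      normal_imp_subgroup Ker_normal)

lemma carrier_tensor_module: "carrier X = cls ` carrier Fr"
  by (simp add: tensor_module_def tensor_group_def carrier_FactGroup)

lemma abelian_group_tensor_module: "abelian_group X"
proof -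
  interpret G: comm_group "tensor_group K V S" by (rule comm_group_tensor_group)
  show ?thesis
  proof (rule abelian_groupI)
    fix x assume "x \<in> carrier X"
    then show "\<exists>y\<in>carrier X. y \<oplus>\<^bsub>X\<^esub> x = \<zero>\<^bsub>X\<^esub>"
      by (intro bexI[of _ "inv\<^bsub>tensor_group K V S\<^esub> x"]) (simp_all add: tensor_module_def)
  qed (simp_all add: tensor_module_def G.m_assoc G.m_comm G.m_lcomm)
qed

sublocale X: abelian_group X
  by (rule abelian_group_tensor_module)

lemma cls_in [intro]: "c \<in> carrier Fr \<Longrightarrow> cls c \<in> carrier X"
  by (auto simp: carrier_tensor_module)

lemma cls_add: "c \<in> carrier Fr \<Longrightarrow> d \<in> carrier Fr \<Longrightarrow> cls (c + d) = cls c \<oplus>\<^bsub>X\<^esub> cls d"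
  using hom_mult[OF normal.r_coset_hom_Mod[OF Ker_normal], of c d]
  by (simp add: tensor_module_def tensor_group_def)

lemma cls_zero: "cls 0 = \<zero>\<^bsub>X\<^esub>"
  using cls_add[of 0 0] cls_in[of 0] X.add.r_cancel_one'[of "cls 0" "cls 0"] by simp

lemma cls_minus: "c \<in> carrier Fr \<Longrightarrow> cls (- c) = \<ominus>\<^bsub>X\<^esub> cls c"
  using cls_add[of "- c" c] X.minus_equality[of "cls (- c)" "cls c"] by (simp add: cls_in cls_zero)

lemma cls_diff: "c \<in> carrier Fr \<Longrightarrow> d \<in> carrier Fr \<Longrightarrow> cls (c - d) = cls c \<ominus>\<^bsub>X\<^esub> cls d"
  using cls_add[of c "- d"] by (simp add: cls_minus a_minus_def)

lemma cls_relator: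
  assumes "r \<in> tensor_relators K V S"
  shows "cls r = \<zero>\<^bsub>X\<^esub>"
proof -
  have sub: "subgroup Ker Fr" by (rule normal_imp_subgroup[OF Ker_normal])
  have "cls r = Ker"
    using subsetD[OF relators_closed assms] relator_in_Ker[OF assms]
    by (intro group.coset_join2[OF group_free_Abelian_group _ sub])
  moreover have "cls 0 = Ker"
    using subgroup.one_closed[OF sub]
    by (intro group.coset_join2[OF group_free_Abelian_group _ sub]) auto
  ultimately show ?thesis by (simp add: cls_zero)
qed

lemma cls_frag_of: "cls (frag_of (v, s)) = v \<otimes>\<^sub>t s"
  by (simp add: pure_tensor_def)

lemma pure_closed [simp, intro]:
  "v \<in> carrier V \<Longrightarrow> s \<in> carrier S \<Longrightarrow> v \<otimes>\<^sub>t s \<in> carrier X"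
  unfolding cls_frag_of[symmetric] by (intro cls_in frag_of_in)

lemma eq_of_diff_zero:
  "a \<in> carrier X \<Longrightarrow> b \<in> carrier X \<Longrightarrow> a \<ominus>\<^bsub>X\<^esub> b = \<zero>\<^bsub>X\<^esub> \<Longrightarrow> a = b"
  using X.minus_equality[of a "\<ominus>\<^bsub>X\<^esub> b"] by (simp add: a_minus_def)

lemma eq_sum_of_diff_zero:
  assumes "a \<in> carrier X" "b \<in> carrier X" "c \<in> carrier X"
    and "a \<ominus>\<^bsub>X\<^esub> b \<ominus>\<^bsub>X\<^esub> c = \<zero>\<^bsub>X\<^esub>"
  shows "a = b \<oplus>\<^bsub>X\<^esub> c"
proof -
  have "c = a \<ominus>\<^bsub>X\<^esub> b"
    using assms eq_of_diff_zero[of "a \<ominus>\<^bsub>X\<^esub> b" c] by simp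
  then show ?thesis
    using assms by (simp add: a_minus_def X.a_lcomm X.r_neg)
qed

lemma pure_add_left:
  assumes "v \<in> carrier V" "w \<in> carrier V" "s \<in> carrier S"
  shows "(v \<oplus>\<^bsub>V\<^esub> w) \<otimes>\<^sub>t s = v \<otimes>\<^sub>t s \<oplus>\<^bsub>X\<^esub> w \<otimes>\<^sub>t s"
proof -
  have "frag_of (v \<oplus>\<^bsub>V\<^esub> w, s) - frag_of (v, s) - frag_of (w, s) \<in> tensor_relators K V S"
    unfolding tensor_relators_def using assms by blast
  from cls_relator[OF this] show ?thesis
    using assms by (intro eq_sum_of_diff_zero)
       (simp_all add: cls_frag_of cls_diff diff_in_Fr frag_of_in
          del: carrier_free_Abelian_group_iff frag_of_in_free_Abelian_group)
qed

lemma pure_add_right: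
  assumes "v \<in> carrier V" "s \<in> carrier S" "t \<in> carrier S"
  shows "v \<otimes>\<^sub>t (s \<oplus>\<^bsub>S\<^esub> t) = v \<otimes>\<^sub>t s \<oplus>\<^bsub>X\<^esub> v \<otimes>\<^sub>t t"
proof -
  have "frag_of (v, s \<oplus>\<^bsub>S\<^esub> t) - frag_of (v, s) - frag_of (v, t) \<in> tensor_relators K V S"
    unfolding tensor_relators_def using assms by blast
  from cls_relator[OF this] show ?thesis
    using assms by (intro eq_sum_of_diff_zero)
       (simp_all add: cls_frag_of cls_diff diff_in_Fr frag_of_in
          del: carrier_free_Abelian_group_iff frag_of_in_free_Abelian_group)
qed

lemma pure_smult:
  assumes "k \<in> carrier K" "v \<in> carrier V" "s \<in> carrier S"
  shows "(k \<odot>\<^bsub>V\<^esub> v) \<otimes>\<^sub>t s = v \<otimes>\<^sub>t (k \<odot>\<^bsub>S\<^esub> s)"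
proof -
  have "frag_of (k \<odot>\<^bsub>V\<^esub> v, s) - frag_of (v, k \<odot>\<^bsub>S\<^esub> s) \<in> tensor_relators K V S"
    unfolding tensor_relators_def using assms by blast
  from cls_relator[OF this] have eq: "(k \<odot>\<^bsub>V\<^esub> v) \<otimes>\<^sub>t s \<ominus>\<^bsub>X\<^esub> v \<otimes>\<^sub>t (k \<odot>\<^bsub>S\<^esub> s) = \<zero>\<^bsub>X\<^esub>"
    using assms by (simp add: cls_diff cls_frag_of frag_of_in
      del: carrier_free_Abelian_group_iff frag_of_in_free_Abelian_group)
  show ?thesis
    by (intro eq_of_diff_zero[OF _ _ eq] pure_closed V.smult_closed S.smult_closed assms)
qed

lemma pure_zero_left [simp]: "s \<in> carrier S \<Longrightarrow> \<zero>\<^bsub>V\<^esub> \<otimes>\<^sub>t s = \<zero>\<^bsub>X\<^esub>"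
  using pure_add_left[of "\<zero>\<^bsub>V\<^esub>" "\<zero>\<^bsub>V\<^esub>" s] X.add.r_cancel_one'[of "\<zero>\<^bsub>V\<^esub> \<otimes>\<^sub>t s" "\<zero>\<^bsub>V\<^esub> \<otimes>\<^sub>t s"]
  by simp

lemma pure_zero_right [simp]: "v \<in> carrier V \<Longrightarrow> v \<otimes>\<^sub>t \<zero>\<^bsub>S\<^esub> = \<zero>\<^bsub>X\<^esub>"
  using pure_add_right[of v "\<zero>\<^bsub>S\<^esub>" "\<zero>\<^bsub>S\<^esub>"] X.add.r_cancel_one'[of "v \<otimes>\<^sub>t \<zero>\<^bsub>S\<^esub>" "v \<otimes>\<^sub>t \<zero>\<^bsub>S\<^esub>"]
  by simp

lemma minus_zero: "\<ominus>\<^bsub>X\<^esub> \<zero>\<^bsub>X\<^esub> = \<zero>\<^bsub>X\<^esub>"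
  by (rule X.minus_equality) simp_all

lemma pure_minus: "v \<in> carrier V \<Longrightarrow> s \<in> carrier S \<Longrightarrow> (\<ominus>\<^bsub>V\<^esub> v) \<otimes>\<^sub>t s = \<ominus>\<^bsub>X\<^esub> (v \<otimes>\<^sub>t s)"
  using pure_add_left[of "\<ominus>\<^bsub>V\<^esub> v" v s] X.minus_equality[of "(\<ominus>\<^bsub>V\<^esub> v) \<otimes>\<^sub>t s" "v \<otimes>\<^sub>t s"]
  by (simp add: V.l_neg)

text \<open>
  Pure tensors generate additively: the negative of a pure tensor is pure again, so sums are enough
  and the induction has no case for inverses or for zero.
\<close>

lemma tensor_induct [consumes 1, case_names pure add]:
  assumes x: "x \<in> carrier X"
    and pure: "\<And>v s. v \<in> carrier V \<Longrightarrow> s \<in> carrier S \<Longrightarrow> P (v \<otimes>\<^sub>t s)"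
    and add: "\<And>x y. \<lbrakk>x \<in> carrier X; y \<in> carrier X; P x; P y\<rbrakk> \<Longrightarrow> P (x \<oplus>\<^bsub>X\<^esub> y)"
  shows "P x"
proof -
  have "P (cls c) \<and> P (\<ominus>\<^bsub>X\<^esub> cls c)" if "Poly_Mapping.keys c \<subseteq> carrier V \<times> carrier S" for c
    using that
  proof (rule free_Abelian_group_induct)
    show "P (cls 0) \<and> P (\<ominus>\<^bsub>X\<^esub> cls 0)"
      using pure[of "\<zero>\<^bsub>V\<^esub>" "\<zero>\<^bsub>S\<^esub>"]
      by (simp add: cls_zero minus_zero)
  next
    fix c d :: "('v \<times> 'u) \<Rightarrow>\<^sub>0 int"
    assume cd: "Poly_Mapping.keys c \<subseteq> carrier V \<times> carrier S" "Poly_Mapping.keys d \<subseteq> carrier V \<times> carrier S"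
      and IH: "P (cls c) \<and> P (\<ominus>\<^bsub>X\<^esub> cls c)" "P (cls d) \<and> P (\<ominus>\<^bsub>X\<^esub> cls d)"
    have *: "cls c \<in> carrier X" "cls d \<in> carrier X" "cls (c - d) = cls c \<ominus>\<^bsub>X\<^esub> cls d"
      using cd by (simp_all add: cls_diff cls_in)
    then have "\<ominus>\<^bsub>X\<^esub> cls (c - d) = \<ominus>\<^bsub>X\<^esub> cls c \<oplus>\<^bsub>X\<^esub> cls d"
      by (simp add: a_minus_def X.minus_add)
    with * IH add show "P (cls (c - d)) \<and> P (\<ominus>\<^bsub>X\<^esub> cls (c - d))"
      by (simp add: a_minus_def)
  next
    fix p assume "p \<in> carrier V \<times> carrier S"
    then show "P (cls (frag_of p)) \<and> P (\<ominus>\<^bsub>X\<^esub> cls (frag_of p))"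
      using pure[of "fst p" "snd p"] pure[of "\<ominus>\<^bsub>V\<^esub> fst p" "snd p"]
      by (auto simp: cls_frag_of pure_minus)
  qed
  then show ?thesis using x by (auto simp: carrier_tensor_module)
qed

text \<open>
  Extend b to the free abelian group.  Since b is balanced, the extension kills the relators and
  hence the subgroup generated by them, so it is constant on every coset; this constant is what
  \<open>the_elem\<close> extracts in \<open>tensor_lift\<close>.
\<close>

lemma tensor_lift_cls:
  assumes G: "comm_group G" and carr: "carrier G = carrier Y" and mult: "monoid.mult G = ring.add Y"
    and b: "balanced K V S Y b"
  shows "\<exists>h \<in> hom Fr G. (\<forall>v\<in>carrier V. \<forall>s\<in>carrier S. h (frag_of (v, s)) = b v s) \<and>
           (\<forall>c\<in>carrier Fr. tensor_lift G b (cls c) = h c)"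
proof -
  interpret G: comm_group G by fact
  have cl: "(\<lambda>p. b (fst p) (snd p)) ` (carrier V \<times> carrier S) \<subseteq> carrier G"
    using b by (auto simp: balanced_def carr)
  obtain h where h: "h \<in> hom Fr G" "\<And>p. p \<in> carrier V \<times> carrier S \<Longrightarrow> h (frag_of p) = b (fst p) (snd p)"
    using G.free_Abelian_group_universal[OF cl] by metis
  interpret h: group_hom Fr G h
    using h by (simp add: group_hom_def group_hom_axioms_def G.is_group)
  have diff: "h (c - d) = h c \<otimes>\<^bsub>G\<^esub> inv\<^bsub>G\<^esub> h d" if "c \<in> carrier Fr" "d \<in> carrier Fr" for c d
    using h.hom_mult[of c "- d"] h.hom_inv[of d] that by simp
  have hb: "h (frag_of (v, s)) = b v s" "b v s \<in> carrier G" if "v \<in> carrier V" "s \<in> carrier S" for v s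
    using h(2)[of "(v,s)"] that b by (auto simp: balanced_def carr)
  have rel1: "h r = \<one>\<^bsub>G\<^esub>" if r: "r \<in> tensor_relators K V S" for r
  proof -
    have comm: "x \<otimes>\<^bsub>G\<^esub> y \<otimes>\<^bsub>G\<^esub> inv\<^bsub>G\<^esub> x \<otimes>\<^bsub>G\<^esub> inv\<^bsub>G\<^esub> y = \<one>\<^bsub>G\<^esub>"
      if "x \<in> carrier G" "y \<in> carrier G" for x y
      using that G.inv_mult[of x y] G.r_inv[of "x \<otimes>\<^bsub>G\<^esub> y"] by (simp add: G.m_assoc)
    have three: "h (frag_of (v, s) - frag_of (v', s') - frag_of (v'', s'')) = \<one>\<^bsub>G\<^esub>"
      if "v \<in> carrier V" "v' \<in> carrier V" "v'' \<in> carrier V"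
        "s \<in> carrier S" "s' \<in> carrier S" "s'' \<in> carrier S" "b v s = b v' s' \<otimes>\<^bsub>G\<^esub> b v'' s''"
      for v v' v'' s s' s''
      using that hb
      by (simp add: diff diff_in_Fr frag_of_in comm
          del: carrier_free_Abelian_group_iff frag_of_in_free_Abelian_group)
    have two: "h (frag_of (v, s) - frag_of (v', s')) = \<one>\<^bsub>G\<^esub>"
      if "v \<in> carrier V" "v' \<in> carrier V" "s \<in> carrier S" "s' \<in> carrier S" "b v s = b v' s'"
      for v v' s s'
      using that hb by (simp add: diff frag_of_in
          del: carrier_free_Abelian_group_iff frag_of_in_free_Abelian_group)
    from r b show ?thesis
      unfolding tensor_relators_def balanced_def
      by (elim UnE CollectE exE conjE) (auto intro!: three two simp: mult)
  qed
  have "Ker \<subseteq> kernel Fr G h"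
    unfolding tensor_kernel_def
    using rel1 relators_closed
    by (intro group.generate_subgroup_incl h.subgroup_kernel group_free_Abelian_group)
       (auto simp: kernel_def simp del: carrier_free_Abelian_group_iff)
  then have K0: "k \<in> carrier Fr" "h k = \<one>\<^bsub>G\<^esub>" if "k \<in> Ker" for k
    using that by (auto simp: kernel_def)
  let ?\<Phi> = "\<lambda>c. finprod G (\<lambda>p. b (fst p) (snd p) [^]\<^bsub>G\<^esub> Poly_Mapping.lookup c p) (Poly_Mapping.keys c)"
  have \<Phi>: "?\<Phi> c = h c" if "c \<in> carrier Fr" for c
  proof -
    have sub: "Poly_Mapping.keys c \<subseteq> carrier V \<times> carrier S" using that by simp
    show ?thesis
      unfolding hom_free_Abelian_group_eq_finprod[OF G h(1) sub]
      using sub by (intro G.finprod_cong') (auto simp: h(2) intro!: G.int_pow_closed hb(2))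
  qed
  have "tensor_lift G b (cls c) = h c" if c: "c \<in> carrier Fr" for c
    unfolding tensor_lift_def
  proof (rule the_elem_image_unique)
    have "\<one>\<^bsub>Fr\<^esub> \<in> Ker"
      using subgroup.one_closed[OF normal_imp_subgroup[OF Ker_normal]] .
    then show "cls c \<noteq> {}" by (auto simp: r_coset_def)
    fix d assume "d \<in> cls c"
    then obtain k where k: "k \<in> Ker" "d = k + c" by (auto simp: r_coset_def)
    then have "d \<in> carrier Fr" "h d = h c"
      using K0[OF k(1)] h.hom_mult[of k c] c h.hom_closed[OF c] keys_add[of k c] by auto
    then show "?\<Phi> d = h c" using \<Phi> by simp
  qed
  then show ?thesis
    using h(1) hb(1) by (intro bexI[of _ h] conjI ballI)
qed

text \<open>
  The target G of a lift is a multiplicative record and Y an additive one with the same underlying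
  group.  Both the additive monoid of a module and the group \<open>tensor_group\<close> occur as G below.
\<close>

lemma tensor_lift:
  assumes G: "comm_group G" and carr: "carrier G = carrier Y" and mult: "monoid.mult G = ring.add Y"
    and b: "balanced K V S Y b"
  shows "x \<in> carrier X \<Longrightarrow> tensor_lift G b x \<in> carrier Y"
    and "x \<in> carrier X \<Longrightarrow> y \<in> carrier X \<Longrightarrow>
      tensor_lift G b (x \<oplus>\<^bsub>X\<^esub> y) = tensor_lift G b x \<oplus>\<^bsub>Y\<^esub> tensor_lift G b y"
    and "v \<in> carrier V \<Longrightarrow> s \<in> carrier S \<Longrightarrow> tensor_lift G b (v \<otimes>\<^sub>t s) = b v s"
proof -
  obtain h where h: "h \<in> hom Fr G" "\<And>v s. v \<in> carrier V \<Longrightarrow> s \<in> carrier S \<Longrightarrow> h (frag_of (v, s)) = b v s"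
    "\<And>c. c \<in> carrier Fr \<Longrightarrow> tensor_lift G b (cls c) = h c"
    using tensor_lift_cls[OF assms] by metis
  show "tensor_lift G b x \<in> carrier Y" if "x \<in> carrier X"
    using that h(1) unfolding carrier_tensor_module by (auto simp: h(3) hom_def Pi_def carr)
  show "tensor_lift G b (x \<oplus>\<^bsub>X\<^esub> y) = tensor_lift G b x \<oplus>\<^bsub>Y\<^esub> tensor_lift G b y"
    if xy: "x \<in> carrier X" "y \<in> carrier X"
  proof -
    obtain c d where cd: "c \<in> carrier Fr" "x = cls c" "d \<in> carrier Fr" "y = cls d"
      using xy unfolding carrier_tensor_module by blast
    have "c + d \<in> carrier Fr" using cd keys_add[of c d] by auto
    then show ?thesis
      using h(3)[of "c + d"] hom_mult[OF h(1), of c d] cd h(3)[of c] h(3)[of d]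
      by (simp add: mult flip: cls_add)
  qed
  show "tensor_lift G b (v \<otimes>\<^sub>t s) = b v s" if "v \<in> carrier V" "s \<in> carrier S"
    using that h(2)[OF that] h(3)[OF frag_of_in[OF that]] by (simp add: cls_frag_of)
qed

lemmas tensor_lift_add_monoid =
  tensor_lift[OF abelian_group.a_comm_group, of Y Y for Y, simplified]

lemma tensor_lift_tensor_group:
  assumes "tensor_product K W T" and b: "balanced K V S (tensor_module K W T) b"
  shows "x \<in> carrier X \<Longrightarrow> tensor_lift (tensor_group K W T) b x \<in> carrier (tensor_module K W T)"
    and "x \<in> carrier X \<Longrightarrow> y \<in> carrier X \<Longrightarrow> tensor_lift (tensor_group K W T) b (x \<oplus>\<^bsub>X\<^esub> y) =
      tensor_lift (tensor_group K W T) b x \<oplus>\<^bsub>tensor_module K W T\<^esub> tensor_lift (tensor_group K W T) b y"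
    and "v \<in> carrier V \<Longrightarrow> s \<in> carrier S \<Longrightarrow> tensor_lift (tensor_group K W T) b (v \<otimes>\<^sub>t s) = b v s"
  by (rule tensor_lift[OF tensor_product.comm_group_tensor_group[OF assms(1)] _ _ b];
      simp add: tensor_module_def)+

end

section \<open>Functoriality of the tensor product\<close>

definition linear_map ::
  "'u ring \<Rightarrow> ('u, 'v) module \<Rightarrow> ('u, 'w) module \<Rightarrow> ('v \<Rightarrow> 'w) \<Rightarrow> bool" where
  "linear_map K V W p \<longleftrightarrow>
     (\<forall>v\<in>carrier V. p v \<in> carrier W) \<and>
     (\<forall>v\<in>carrier V. \<forall>w\<in>carrier V. p (v \<oplus>\<^bsub>V\<^esub> w) = p v \<oplus>\<^bsub>W\<^esub> p w) \<and>
     (\<forall>k\<in>carrier K. \<forall>v\<in>carrier V. p (k \<odot>\<^bsub>V\<^esub> v) = k \<odot>\<^bsub>W\<^esub> p v)"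

lemma linear_map_identity: "linear_map K V V (\<lambda>v. v)"
  by (simp add: linear_map_def)

text \<open>
  The map \<open>v \<otimes> s \<mapsto> p v \<otimes> \<phi> s\<close> needs only that p and \<phi> are K-linear.  This covers base change along
  an algebra morphism, scalar multiplication (\<phi> multiplication by a fixed element), inclusions of
  submodules and retractions onto them.
\<close>

definition tensor_map ::
  "'u ring \<Rightarrow> ('u, 'w) module \<Rightarrow> 'u calg \<Rightarrow> ('v \<Rightarrow> 'w) \<Rightarrow> ('u \<Rightarrow> 'u) \<Rightarrow> ('v, 'u) tensor \<Rightarrow> ('w, 'u) tensor"
  where "tensor_map K W T p \<phi> = tensor_lift (tensor_group K W T) (\<lambda>v s. pure_tensor K W T (p v) (\<phi> s))"

lemma tensor_productI: "module K V \<Longrightarrow> algebra K S \<Longrightarrow> tensor_product K V S"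
  by (simp add: tensor_product_def)

lemma tensor_map:
  assumes "tensor_product K V S" "tensor_product K W T"
    and p: "linear_map K V W p" and \<phi>: "linear_map K S T \<phi>"
  shows tensor_map_closed:
      "x \<in> carrier (tensor_module K V S) \<Longrightarrow> tensor_map K W T p \<phi> x \<in> carrier (tensor_module K W T)"
    and tensor_map_add:
      "\<lbrakk>x \<in> carrier (tensor_module K V S); y \<in> carrier (tensor_module K V S)\<rbrakk> \<Longrightarrow>
       tensor_map K W T p \<phi> (x \<oplus>\<^bsub>tensor_module K V S\<^esub> y) =
       tensor_map K W T p \<phi> x \<oplus>\<^bsub>tensor_module K W T\<^esub> tensor_map K W T p \<phi> y"
    and tensor_map_pure:
      "\<lbrakk>v \<in> carrier V; s \<in> carrier S\<rbrakk> \<Longrightarrow>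
       tensor_map K W T p \<phi> (pure_tensor K V S v s) = pure_tensor K W T (p v) (\<phi> s)"
proof -
  interpret A: tensor_product K V S by fact
  interpret B: tensor_product K W T by fact
  have "balanced K V S B.X (\<lambda>v s. pure_tensor K W T (p v) (\<phi> s))"
    using p \<phi> unfolding balanced_def linear_map_def
    by (simp add: B.pure_add_left B.pure_add_right B.pure_smult)
  note * = A.tensor_lift_tensor_group[OF assms(2) this, folded tensor_map_def]
  show "x \<in> carrier A.X \<Longrightarrow> tensor_map K W T p \<phi> x \<in> carrier B.X"
    "\<lbrakk>x \<in> carrier A.X; y \<in> carrier A.X\<rbrakk> \<Longrightarrow>
       tensor_map K W T p \<phi> (x \<oplus>\<^bsub>A.X\<^esub> y) = tensor_map K W T p \<phi> x \<oplus>\<^bsub>B.X\<^esub> tensor_map K W T p \<phi> y"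
    "\<lbrakk>v \<in> carrier V; s \<in> carrier S\<rbrakk> \<Longrightarrow>
       tensor_map K W T p \<phi> (pure_tensor K V S v s) = pure_tensor K W T (p v) (\<phi> s)"
    by (rule *; assumption)+
qed

context tensor_product
begin

lemma linear_map_mult: "s \<in> carrier S \<Longrightarrow> linear_map K S S (\<lambda>t. s \<otimes>\<^bsub>S\<^esub> t)"
  unfolding linear_map_def
  using S.smult_assoc2 S.m_comm by (simp add: S.r_distr)

lemma smult_eq_tensor_map: "s \<odot>\<^bsub>X\<^esub> x = tensor_map K V S (\<lambda>v. v) (\<lambda>t. s \<otimes>\<^bsub>S\<^esub> t) x"
  by (simp add: tensor_module_def tensor_map_def)

lemma smult_closed: "s \<in> carrier S \<Longrightarrow> x \<in> carrier X \<Longrightarrow> s \<odot>\<^bsub>X\<^esub> x \<in> carrier X"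
  unfolding smult_eq_tensor_map
  by (rule tensor_map_closed[OF tensor_product_axioms tensor_product_axioms linear_map_identity linear_map_mult])

lemma smult_add: "s \<in> carrier S \<Longrightarrow> x \<in> carrier X \<Longrightarrow> y \<in> carrier X \<Longrightarrow>
    s \<odot>\<^bsub>X\<^esub> (x \<oplus>\<^bsub>X\<^esub> y) = s \<odot>\<^bsub>X\<^esub> x \<oplus>\<^bsub>X\<^esub> s \<odot>\<^bsub>X\<^esub> y"
  unfolding smult_eq_tensor_map
  by (rule tensor_map_add[OF tensor_product_axioms tensor_product_axioms linear_map_identity linear_map_mult])

lemma smult_pure: "s \<in> carrier S \<Longrightarrow> v \<in> carrier V \<Longrightarrow> t \<in> carrier S \<Longrightarrow>
    s \<odot>\<^bsub>X\<^esub> (v \<otimes>\<^sub>t t) = v \<otimes>\<^sub>t (s \<otimes>\<^bsub>S\<^esub> t)"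
  unfolding smult_eq_tensor_map
  by (rule tensor_map_pure[OF tensor_product_axioms tensor_product_axioms linear_map_identity linear_map_mult])

lemma module_tensor_module: "module S X"
proof (rule moduleI)
  show "cring S" "abelian_group X" by (rule S.M_cring X.abelian_group_axioms)+
  show "s \<odot>\<^bsub>X\<^esub> x \<in> carrier X" if "s \<in> carrier S" "x \<in> carrier X" for s x
    by (rule smult_closed[OF that])
  show "s \<odot>\<^bsub>X\<^esub> (x \<oplus>\<^bsub>X\<^esub> y) = s \<odot>\<^bsub>X\<^esub> x \<oplus>\<^bsub>X\<^esub> s \<odot>\<^bsub>X\<^esub> y"
    if "s \<in> carrier S" "x \<in> carrier X" "y \<in> carrier X" for s x y
    by (rule smult_add[OF that])
  show "(s \<oplus>\<^bsub>S\<^esub> t) \<odot>\<^bsub>X\<^esub> x = s \<odot>\<^bsub>X\<^esub> x \<oplus>\<^bsub>X\<^esub> t \<odot>\<^bsub>X\<^esub> x"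
    if s: "s \<in> carrier S" "t \<in> carrier S" and "x \<in> carrier X" for s t x
    using that(3)
  proof (induction rule: tensor_induct)
    case (pure v r)
    then show ?case using s by (simp add: smult_pure S.l_distr pure_add_right)
  next
    case (add x y)
    then show ?case using s by (simp add: smult_add smult_closed X.add.m_ac)
  qed
  show "(s \<otimes>\<^bsub>S\<^esub> t) \<odot>\<^bsub>X\<^esub> x = s \<odot>\<^bsub>X\<^esub> (t \<odot>\<^bsub>X\<^esub> x)"
    if s: "s \<in> carrier S" "t \<in> carrier S" and "x \<in> carrier X" for s t x
    using that(3)
  proof (induction rule: tensor_induct)
    case (pure v r)
    then show ?case using s by (simp add: smult_pure S.m_assoc)
  next
    case (add x y)
    then show ?case using s by (simp add: smult_add smult_closed)
  qed
  show "\<one>\<^bsub>S\<^esub> \<odot>\<^bsub>X\<^esub> x = x" if "x \<in> carrier X" for x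
    using that
  proof (induction rule: tensor_induct)
    case (pure v r)
    then show ?case by (simp add: smult_pure)
  next
    case (add x y)
    then show ?case by (simp add: smult_add smult_closed)
  qed
qed

end

lemma alg_homD:
  assumes "\<phi> \<in> alg_hom K S T"
  shows "\<phi> \<in> ring_hom S T" and "s \<in> carrier S \<Longrightarrow> \<phi> s \<in> carrier T"
    and "\<lbrakk>k \<in> carrier K; s \<in> carrier S\<rbrakk> \<Longrightarrow> \<phi> (k \<odot>\<^bsub>S\<^esub> s) = k \<odot>\<^bsub>T\<^esub> \<phi> s"
  using assms by (auto simp: alg_hom_def ring_hom_def)

lemma linear_map_alg_hom: "\<phi> \<in> alg_hom K S T \<Longrightarrow> linear_map K S T \<phi>"
  using alg_homD[of \<phi> K S T] by (simp add: linear_map_def ring_hom_add)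

text \<open>
  Elements of S act on the right-hand factor, where \<phi> is multiplicative.
\<close>

lemma tensor_map_semilinear:
  assumes A: "tensor_product K V S" and B: "tensor_product K W T"
    and p: "linear_map K V W p" and \<phi>: "\<phi> \<in> alg_hom K S T"
    and s: "s \<in> carrier S" and x: "x \<in> carrier (tensor_module K V S)"
  shows "tensor_map K W T p \<phi> (s \<odot>\<^bsub>tensor_module K V S\<^esub> x) =
    \<phi> s \<odot>\<^bsub>tensor_module K W T\<^esub> tensor_map K W T p \<phi> x"
proof -
  interpret A: tensor_product K V S by fact
  interpret B: tensor_product K W T by fact
  note tm = tensor_map[OF A B p linear_map_alg_hom[OF \<phi>]]
  have pv: "p v \<in> carrier W" if "v \<in> carrier V" for v using p that by (simp add: linear_map_def)
  show ?thesis
    using x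
  proof (induction rule: A.tensor_induct)
    case (pure v t)
    then show ?case
      using s alg_homD[OF \<phi>] pv
      by (simp add: tm A.smult_pure B.smult_pure ring_hom_mult)
  next
    case (add x y)
    then show ?case
      using s alg_homD[OF \<phi>] by (simp add: tm A.smult_add B.smult_add A.smult_closed)
  qed
qed

lemma tensor_map_compose:
  assumes A: "tensor_product K V S" and B: "tensor_product K W T" and C: "tensor_product K Z U"
    and p: "linear_map K V W p" and \<phi>: "linear_map K S T \<phi>"
    and q: "linear_map K W Z q" and \<psi>: "linear_map K T U \<psi>"
    and r: "linear_map K V Z r" "\<And>v. v \<in> carrier V \<Longrightarrow> r v = q (p v)"
    and \<chi>: "linear_map K S U \<chi>" "\<And>s. s \<in> carrier S \<Longrightarrow> \<chi> s = \<psi> (\<phi> s)"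
    and x: "x \<in> carrier (tensor_module K V S)"
  shows "tensor_map K Z U r \<chi> x = tensor_map K Z U q \<psi> (tensor_map K W T p \<phi> x)"
proof -
  interpret A: tensor_product K V S by fact
  note 1 = tensor_map[OF A B p \<phi>] and 2 = tensor_map[OF B C q \<psi>] and 3 = tensor_map[OF A C r(1) \<chi>(1)]
  have cl: "p v \<in> carrier W" "\<phi> s \<in> carrier T" if "v \<in> carrier V" "s \<in> carrier S" for v s
    using p \<phi> that by (simp_all add: linear_map_def)
  show ?thesis
    using x
  proof (induction rule: A.tensor_induct)
    case (pure v t)
    then show ?case using cl by (simp add: 1 2 3 r \<chi>)
  next
    case (add x y)
    then show ?case by (simp add: 1 2 3)
  qed
qed

lemma tensor_map_id:
  assumes A: "tensor_product K V S"
    and p: "linear_map K V V p" "\<And>v. v \<in> carrier V \<Longrightarrow> p v = v"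
    and \<phi>: "linear_map K S S \<phi>" "\<And>s. s \<in> carrier S \<Longrightarrow> \<phi> s = s"
    and x: "x \<in> carrier (tensor_module K V S)"
  shows "tensor_map K V S p \<phi> x = x"
proof -
  interpret A: tensor_product K V S by fact
  note tm = tensor_map[OF A A p(1) \<phi>(1)]
  show ?thesis
    using x by (induction rule: A.tensor_induct) (simp_all add: tm p \<phi>)
qed

lemma fobj_quasi_coherent [simp]: "fobj (quasi_coherent K V) S = tensor_module K V S"
  by (simp add: quasi_coherent_def)

lemma fmap_quasi_coherent: "fmap (quasi_coherent K V) S T \<phi> = tensor_map K V T (\<lambda>v. v) \<phi>"
  by (simp add: quasi_coherent_def tensor_map_def)

lemma alg_hom_identity: "(\<lambda>s\<in>carrier S. s) \<in> alg_hom K S S" if "algebra K S"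
proof -
  interpret algebra K S by fact
  show ?thesis by (auto simp: alg_hom_def ring_hom_def)
qed

lemma linear_map_compose_alg_hom:
  assumes "algebra K S" "\<phi> \<in> alg_hom K S T" "\<psi> \<in> alg_hom K T U"
  shows "linear_map K S U (compose (carrier S) \<psi> \<phi>)"
proof -
  interpret algebra K S by fact
  show ?thesis
    using alg_homD[OF assms(2)] alg_homD[OF assms(3)]
    by (simp add: linear_map_def compose_def ring_hom_add)
qed

proposition K_module_functor_quasi_coherent:
  fixes K :: "'u ring"
  assumes V: "module K V"
  shows "K_module_functor K (quasi_coherent K V)"
  unfolding K_module_functor_def fobj_quasi_coherent fmap_quasi_coherent
proof (intro conjI allI impI ballI Pi_I)
  fix S :: "'u calg" assume S: "algebra K S"
  show "module S (tensor_module K V S)"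
    by (rule tensor_product.module_tensor_module[OF tensor_productI[OF V S]])
  show "tensor_map K V S (\<lambda>v. v) (\<lambda>s\<in>carrier S. s) x = x" if "x \<in> carrier (tensor_module K V S)" for x
    using that
    by (intro tensor_map_id[OF tensor_productI[OF V S] linear_map_identity _ linear_map_alg_hom] alg_hom_identity S)
       auto
next
  fix S T :: "'u calg" and \<phi> assume S: "algebra K S" "algebra K T" and \<phi>: "\<phi> \<in> alg_hom K S T"
  note * = tensor_productI[OF V S(1)] tensor_productI[OF V S(2)] linear_map_identity
  show "tensor_map K V T (\<lambda>v. v) \<phi> x \<in> carrier (tensor_module K V T)" if "x \<in> carrier (tensor_module K V S)" for x
    by (rule tensor_map_closed[OF * linear_map_alg_hom[OF \<phi>] that])
  show "tensor_map K V T (\<lambda>v. v) \<phi> (x \<oplus>\<^bsub>tensor_module K V S\<^esub> y) =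
      tensor_map K V T (\<lambda>v. v) \<phi> x \<oplus>\<^bsub>tensor_module K V T\<^esub> tensor_map K V T (\<lambda>v. v) \<phi> y"
    if "x \<in> carrier (tensor_module K V S)" "y \<in> carrier (tensor_module K V S)" for x y
    by (rule tensor_map_add[OF * linear_map_alg_hom[OF \<phi>] that])
  show "tensor_map K V T (\<lambda>v. v) \<phi> (s \<odot>\<^bsub>tensor_module K V S\<^esub> x) =
      \<phi> s \<odot>\<^bsub>tensor_module K V T\<^esub> tensor_map K V T (\<lambda>v. v) \<phi> x"
    if "s \<in> carrier S" "x \<in> carrier (tensor_module K V S)" for s x
    by (rule tensor_map_semilinear[OF * \<phi> that])
next
  fix S T U :: "'u calg" and \<phi> \<psi> x
  assume S: "algebra K S" "algebra K T" "algebra K U"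
    and \<phi>: "\<phi> \<in> alg_hom K S T" and \<psi>: "\<psi> \<in> alg_hom K T U" and x: "x \<in> carrier (tensor_module K V S)"
  show "tensor_map K V U (\<lambda>v. v) (compose (carrier S) \<psi> \<phi>) x =
      tensor_map K V U (\<lambda>v. v) \<psi> (tensor_map K V T (\<lambda>v. v) \<phi> x)"
    by (rule tensor_map_compose[OF S[THEN tensor_productI[OF V]] linear_map_identity
          linear_map_alg_hom[OF \<phi>] linear_map_identity linear_map_alg_hom[OF \<psi>]
          linear_map_identity refl linear_map_compose_alg_hom[OF S(1) \<phi> \<psi>] _ x])
       (simp add: compose_def)
qed

section \<open>Inclusions of submodules\<close>

lemma linear_map_inclusion: "submodule W K V \<Longrightarrow> linear_map K (V\<lparr>carrier := W\<rparr>) V (\<lambda>v. v)"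
  using subgroup.subset[OF submodule.axioms(1)] by (fastforce simp: linear_map_def)

lemma qc_inclusion_eq_tensor_map: "qc_inclusion K V S = tensor_map K V S (\<lambda>v. v) (\<lambda>s. s)"
  by (simp add: qc_inclusion_def tensor_map_def)

lemma K_module_morphism_qc_inclusion:
  fixes K :: "'u ring"
  assumes V: "module K V" and W: "submodule W K V"
  shows "K_module_morphism K (quasi_coherent K (V\<lparr>carrier := W\<rparr>)) (quasi_coherent K V) (qc_inclusion K V)"
  unfolding K_module_morphism_def fobj_quasi_coherent fmap_quasi_coherent qc_inclusion_eq_tensor_map
proof (intro conjI allI impI ballI Pi_I)
  let ?W = "V\<lparr>carrier := W\<rparr>"
  have W': "module K ?W" by (rule submodule.submodule_is_module[OF W V])
  note inc = linear_map_inclusion[OF W]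
  {
    fix S :: "'u calg" assume S: "algebra K S"
    note * = tensor_productI[OF W' S] tensor_productI[OF V S] inc linear_map_identity
    show "tensor_map K V S (\<lambda>v. v) (\<lambda>s. s) x \<in> carrier (tensor_module K V S)"
      if "x \<in> carrier (tensor_module K ?W S)" for x
      by (rule tensor_map_closed[OF * that])
    show "tensor_map K V S (\<lambda>v. v) (\<lambda>s. s) (x \<oplus>\<^bsub>tensor_module K ?W S\<^esub> y) =
        tensor_map K V S (\<lambda>v. v) (\<lambda>s. s) x \<oplus>\<^bsub>tensor_module K V S\<^esub> tensor_map K V S (\<lambda>v. v) (\<lambda>s. s) y"
      if "x \<in> carrier (tensor_module K ?W S)" "y \<in> carrier (tensor_module K ?W S)" for x y
      by (rule tensor_map_add[OF * that])
    show "tensor_map K V S (\<lambda>v. v) (\<lambda>s. s) (s \<odot>\<^bsub>tensor_module K ?W S\<^esub> x) =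
        s \<odot>\<^bsub>tensor_module K V S\<^esub> tensor_map K V S (\<lambda>v. v) (\<lambda>s. s) x"
      if s: "s \<in> carrier S" and "x \<in> carrier (tensor_module K ?W S)" for s x
    proof -
      interpret A: tensor_product K ?W S by fact
      interpret B: tensor_product K V S by fact
      have WV: "v \<in> carrier V" if "v \<in> W" for v
        using that subgroup.subset[OF submodule.axioms(1)[OF W]] by auto
      show ?thesis
        using that(2)
        by (induction rule: A.tensor_induct)
           (use s WV in \<open>simp_all add: tensor_map[OF *] A.smult_pure B.smult_pure A.smult_add B.smult_add A.smult_closed\<close>)
    qed
  }
  fix S T :: "'u calg" and \<phi> x assume S: "algebra K S" "algebra K T" and \<phi>: "\<phi> \<in> alg_hom K S T"
    and x: "x \<in> carrier (tensor_module K ?W S)"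
  note l = linear_map_alg_hom[OF \<phi>]
  have "tensor_map K V T (\<lambda>v. v) \<phi> x = tensor_map K V T (\<lambda>v. v) (\<lambda>s. s) (tensor_map K ?W T (\<lambda>v. v) \<phi> x)"
    by (rule tensor_map_compose[OF tensor_productI[OF W' S(1)] tensor_productI[OF W' S(2)]
          tensor_productI[OF V S(2)] linear_map_identity l inc linear_map_identity inc refl l refl x])
  moreover have "tensor_map K V T (\<lambda>v. v) \<phi> x = tensor_map K V T (\<lambda>v. v) \<phi> (tensor_map K V S (\<lambda>v. v) (\<lambda>s. s) x)"
    by (rule tensor_map_compose[OF tensor_productI[OF W' S(1)] tensor_productI[OF V S(1)]
          tensor_productI[OF V S(2)] inc linear_map_identity linear_map_identity l inc refl l refl x])
  ultimately show "tensor_map K V T (\<lambda>v. v) (\<lambda>s. s) (tensor_map K ?W T (\<lambda>v. v) \<phi> x) =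
      tensor_map K V T (\<lambda>v. v) \<phi> (tensor_map K V S (\<lambda>v. v) (\<lambda>s. s) x)"
    by simp
qed

section \<open>The ground ring as an algebra over itself\<close>

lemma self_alg_simps [simp]:
  "carrier (self_alg K) = carrier K" "monoid.mult (self_alg K) = monoid.mult K" "one (self_alg K) = one K"
  "ring.add (self_alg K) = ring.add K" "ring.zero (self_alg K) = ring.zero K"
  "smult (self_alg K) = monoid.mult K"
  by (simp_all add: self_alg_def ring.extend_def module.fields_def)

lemma algebra_self_alg:
  assumes "cring K"
  shows "algebra K (self_alg K)"
proof -
  interpret cring K by fact
  have "cring (self_alg K)"
  proof (rule cringI)
    show "abelian_group (self_alg K)"
    proof (rule abelian_groupI)
      show "\<exists>y\<in>carrier (self_alg K). y \<oplus>\<^bsub>self_alg K\<^esub> x = \<zero>\<^bsub>self_alg K\<^esub>"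
        if "x \<in> carrier (self_alg K)" for x
        using that l_neg[of x] by (intro bexI[of _ "\<ominus>\<^bsub>K\<^esub> x"]) auto
    qed (auto simp: a_ac)
    show "comm_monoid (self_alg K)"
      by (rule comm_monoidI) (auto simp: m_ac)
  qed (simp add: l_distr)
  then show ?thesis
    using assms by (intro algebraI) (simp_all add: l_distr r_distr m_assoc)
qed

lemma algebra_self_alg_iff:
  assumes "cring K"
  shows "algebra (self_alg K) T \<longleftrightarrow> algebra K T"
proof -
  have c: "cring (self_alg K)" using algebra.M_cring[OF algebra_self_alg[OF assms]] .
  show ?thesis
    using assms c by (simp add: algebra_def module_def module_axioms_def algebra_axioms_def)
qed

lemma struct_map_alg_hom:
  assumes "algebra K S"
  shows "struct_map K S \<in> alg_hom K (self_alg K) S"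
proof -
  interpret algebra K S by fact
  show ?thesis
    by (auto simp: alg_hom_def struct_map_def ring_hom_def smult_assoc1 smult_assoc2 smult_l_distr)
qed

section \<open>Linear algebra over a field\<close>

lemma submodule_subset: "submodule W K V \<Longrightarrow> W \<subseteq> carrier V"
  using subgroup.subset[OF submodule.axioms(1)] by fastforce

lemma submodule_zero: "submodule W K V \<Longrightarrow> \<zero>\<^bsub>V\<^esub> \<in> W"
  using subgroup.one_closed[OF submodule.axioms(1)] by fastforce

lemma submodule_add: "submodule W K V \<Longrightarrow> x \<in> W \<Longrightarrow> y \<in> W \<Longrightarrow> x \<oplus>\<^bsub>V\<^esub> y \<in> W"
  using subgroup.m_closed[OF submodule.axioms(1)] by fastforce

lemma submodule_line:
  assumes "module K V" and v: "v \<in> carrier V"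
  shows "submodule ((\<lambda>k. k \<odot>\<^bsub>V\<^esub> v) ` carrier K) K V"
proof -
  interpret V: module K V by fact
  show ?thesis
  proof (rule V.submoduleI)
    show "\<zero>\<^bsub>V\<^esub> \<in> (\<lambda>k. k \<odot>\<^bsub>V\<^esub> v) ` carrier K"
      using v by (intro image_eqI[of _ _ "\<zero>\<^bsub>K\<^esub>"]) simp_all
    show "\<ominus>\<^bsub>V\<^esub> a \<in> (\<lambda>k. k \<odot>\<^bsub>V\<^esub> v) ` carrier K" if "a \<in> (\<lambda>k. k \<odot>\<^bsub>V\<^esub> v) ` carrier K" for a
      using that v by (auto simp flip: V.smult_l_minus)
    show "a \<oplus>\<^bsub>V\<^esub> b \<in> (\<lambda>k. k \<odot>\<^bsub>V\<^esub> v) ` carrier K"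
      if "a \<in> (\<lambda>k. k \<odot>\<^bsub>V\<^esub> v) ` carrier K" "b \<in> (\<lambda>k. k \<odot>\<^bsub>V\<^esub> v) ` carrier K" for a b
      using that v by (auto simp flip: V.smult_l_distr)
    show "a \<odot>\<^bsub>V\<^esub> x \<in> (\<lambda>k. k \<odot>\<^bsub>V\<^esub> v) ` carrier K"
      if "a \<in> carrier K" "x \<in> (\<lambda>k. k \<odot>\<^bsub>V\<^esub> v) ` carrier K" for a x
      using that v by (auto simp flip: V.smult_assoc1)
  qed (use v in auto)
qed

lemma submodule_sum:
  assumes "module K V" and A: "submodule A K V" and B: "submodule B K V"
  shows "submodule {a \<oplus>\<^bsub>V\<^esub> b | a b. a \<in> A \<and> b \<in> B} K V"
proof -
  interpret V: module K V by fact
  note sub = subsetD[OF submodule_subset[OF A]] subsetD[OF submodule_subset[OF B]]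
  show ?thesis
  proof (rule V.submoduleI)
    show "{a \<oplus>\<^bsub>V\<^esub> b | a b. a \<in> A \<and> b \<in> B} \<subseteq> carrier V"
      using sub by auto
    show "\<zero>\<^bsub>V\<^esub> \<in> {a \<oplus>\<^bsub>V\<^esub> b | a b. a \<in> A \<and> b \<in> B}"
      using submodule_zero[OF A] submodule_zero[OF B] V.l_zero[of "\<zero>\<^bsub>V\<^esub>"] by force
    show "\<ominus>\<^bsub>V\<^esub> x \<in> {a \<oplus>\<^bsub>V\<^esub> b | a b. a \<in> A \<and> b \<in> B}"
      if x: "x \<in> {a \<oplus>\<^bsub>V\<^esub> b | a b. a \<in> A \<and> b \<in> B}" for x
    proof -
      obtain a b where *: "a \<in> A" "b \<in> B" "x = a \<oplus>\<^bsub>V\<^esub> b"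
        using x by blast
      then have "\<ominus>\<^bsub>V\<^esub> x = \<ominus>\<^bsub>V\<^esub> a \<oplus>\<^bsub>V\<^esub> \<ominus>\<^bsub>V\<^esub> b"
        using sub by (simp add: V.minus_add)
      with * V.submoduleE(3)[OF A] V.submoduleE(3)[OF B] show ?thesis by blast
    qed
    show "x \<oplus>\<^bsub>V\<^esub> y \<in> {a \<oplus>\<^bsub>V\<^esub> b | a b. a \<in> A \<and> b \<in> B}"
      if xy: "x \<in> {a \<oplus>\<^bsub>V\<^esub> b | a b. a \<in> A \<and> b \<in> B}" "y \<in> {a \<oplus>\<^bsub>V\<^esub> b | a b. a \<in> A \<and> b \<in> B}" for x y
    proof -
      obtain a b c d where *: "a \<in> A" "b \<in> B" "c \<in> A" "d \<in> B" "x = a \<oplus>\<^bsub>V\<^esub> b" "y = c \<oplus>\<^bsub>V\<^esub> d"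
        using xy by blast
      then have "x \<oplus>\<^bsub>V\<^esub> y = (a \<oplus>\<^bsub>V\<^esub> c) \<oplus>\<^bsub>V\<^esub> (b \<oplus>\<^bsub>V\<^esub> d)"
        using sub by (simp add: V.add.m_ac)
      with * submodule_add[OF A] submodule_add[OF B] show ?thesis by blast
    qed
    show "k \<odot>\<^bsub>V\<^esub> x \<in> {a \<oplus>\<^bsub>V\<^esub> b | a b. a \<in> A \<and> b \<in> B}"
      if k: "k \<in> carrier K" and x: "x \<in> {a \<oplus>\<^bsub>V\<^esub> b | a b. a \<in> A \<and> b \<in> B}" for k x
    proof -
      obtain a b where *: "a \<in> A" "b \<in> B" "x = a \<oplus>\<^bsub>V\<^esub> b"
        using x by blast
      then have "k \<odot>\<^bsub>V\<^esub> x = k \<odot>\<^bsub>V\<^esub> a \<oplus>\<^bsub>V\<^esub> k \<odot>\<^bsub>V\<^esub> b"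
        using sub k by (simp add: V.smult_r_distr)
      moreover have "k \<odot>\<^bsub>V\<^esub> a \<in> A" "k \<odot>\<^bsub>V\<^esub> b \<in> B"
        using submodule.smult_closed[OF A k] submodule.smult_closed[OF B k] * by auto
      ultimately show ?thesis by blast
    qed
  qed
qed

text \<open>
  Take C maximal among the submodules that contain W and meet U trivially (Zorn).  If some x were
  outside \<open>U + C\<close>, then \<open>C + K x\<close> would be larger, hence would meet U in some \<open>u = c + k x \<noteq> 0\<close>.  Here
  \<open>k \<noteq> 0\<close>, and dividing by k, which is possible over a field, puts x into \<open>U + C\<close> after all.
\<close>

lemma exists_complement:
  assumes "field K" and "module K V" and U: "submodule U K V" and W: "submodule W K V"
    and disj: "U \<inter> W = {\<zero>\<^bsub>V\<^esub>}"
  obtains C where "submodule C K V" "W \<subseteq> C" "U \<inter> C = {\<zero>\<^bsub>V\<^esub>}"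
    "\<And>x. x \<in> carrier V \<Longrightarrow> \<exists>u\<in>U. \<exists>c\<in>C. x = u \<oplus>\<^bsub>V\<^esub> c"
proof -
  interpret K: field K by fact
  interpret V: module K V by fact
  let ?P = "{C. submodule C K V \<and> W \<subseteq> C \<and> U \<inter> C = {\<zero>\<^bsub>V\<^esub>}}"
  have "\<exists>C\<in>?P. \<forall>D\<in>?P. C \<subseteq> D \<longrightarrow> D = C"
  proof (rule subset_Zorn_nonempty)
    show "?P \<noteq> {}" using W disj by blast
    fix Ch assume Ch: "Ch \<noteq> {}" "subset.chain ?P Ch"
    then have mem: "submodule C K V" "W \<subseteq> C" "U \<inter> C = {\<zero>\<^bsub>V\<^esub>}" if "C \<in> Ch" for C
      using that by (auto simp: subset.chain_def)
    have dir: "\<exists>C\<in>Ch. a \<in> C \<and> b \<in> C" if "a \<in> \<Union>Ch" "b \<in> \<Union>Ch" for a b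
      using that Ch(2) unfolding subset_chain_def by blast
    have "submodule (\<Union>Ch) K V"
    proof (rule V.submoduleI)
      show "\<Union>Ch \<subseteq> carrier V" using mem(1) submodule_subset by blast
      show "\<zero>\<^bsub>V\<^esub> \<in> \<Union>Ch" using mem(1) submodule_zero Ch(1) by blast
      show "\<ominus>\<^bsub>V\<^esub> a \<in> \<Union>Ch" if "a \<in> \<Union>Ch" for a
        using that mem(1) V.submoduleE(3) by blast
      show "a \<oplus>\<^bsub>V\<^esub> b \<in> \<Union>Ch" if ab: "a \<in> \<Union>Ch" "b \<in> \<Union>Ch" for a b
      proof -
        obtain C where C: "C \<in> Ch" "a \<in> C" "b \<in> C" using dir[OF ab] by blast
        show ?thesis by (rule UnionI[OF C(1) submodule_add[OF mem(1)[OF C(1)] C(2,3)]])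
      qed
      show "k \<odot>\<^bsub>V\<^esub> a \<in> \<Union>Ch" if k: "k \<in> carrier K" and a: "a \<in> \<Union>Ch" for k a
      proof -
        obtain C where C: "C \<in> Ch" "a \<in> C" using a by blast
        show ?thesis by (rule UnionI[OF C(1) submodule.smult_closed[OF mem(1)[OF C(1)] k C(2)]])
      qed
    qed
    moreover have "W \<subseteq> \<Union>Ch" using mem(2) Ch(1) by blast
    moreover have "U \<inter> \<Union>Ch = {\<zero>\<^bsub>V\<^esub>}" using mem(3) Ch(1) by blast
    ultimately show "\<Union>Ch \<in> ?P" by blast
  qed
  then obtain C where C: "submodule C K V" "W \<subseteq> C" "U \<inter> C = {\<zero>\<^bsub>V\<^esub>}"
    and max: "\<And>D. submodule D K V \<Longrightarrow> U \<inter> D = {\<zero>\<^bsub>V\<^esub>} \<Longrightarrow> C \<subseteq> D \<Longrightarrow> D = C"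
    by (auto dest: order.trans)
  note CV = subsetD[OF submodule_subset[OF C(1)]] and UV = subsetD[OF submodule_subset[OF U]]
  have "\<exists>u\<in>U. \<exists>c\<in>C. x = u \<oplus>\<^bsub>V\<^esub> c" if x: "x \<in> carrier V" for x
  proof (cases "x \<in> C")
    case True
    then show ?thesis using submodule_zero[OF U] V.l_zero[OF x] by metis
  next
    case False
    \<comment> \<open>The submodule \<open>C + K x\<close>, strictly larger than C.\<close>
    let ?D = "{c \<oplus>\<^bsub>V\<^esub> l | c l. c \<in> C \<and> l \<in> (\<lambda>k. k \<odot>\<^bsub>V\<^esub> x) ` carrier K}"
    have D: "submodule ?D K V"
      by (intro submodule_sum C submodule_line x V.module_axioms)
    have lineI: "x \<in> (\<lambda>k. k \<odot>\<^bsub>V\<^esub> x) ` carrier K" "\<zero>\<^bsub>V\<^esub> \<in> (\<lambda>k. k \<odot>\<^bsub>V\<^esub> x) ` carrier K"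
      using x submodule_zero[OF submodule_line[OF V.module_axioms x]]
      by (auto intro: image_eqI[of _ _ "\<one>\<^bsub>K\<^esub>"])
    have "c \<in> ?D" if "c \<in> C" for c
      using that lineI(2) V.r_zero[OF CV[OF that]] by force
    then have "C \<subseteq> ?D" by blast
    moreover have "x \<in> ?D"
      using submodule_zero[OF C(1)] lineI(1) V.l_zero[OF x] by force
    ultimately have "U \<inter> ?D \<noteq> {\<zero>\<^bsub>V\<^esub>}"
      using max[OF D] False by blast
    then obtain u where u: "u \<in> U" "u \<in> ?D" "u \<noteq> \<zero>\<^bsub>V\<^esub>"
      using submodule_zero[OF D] submodule_zero[OF U] by blast
    then obtain c k where ck: "c \<in> C" "k \<in> carrier K" "u = c \<oplus>\<^bsub>V\<^esub> k \<odot>\<^bsub>V\<^esub> x"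
      by blast
    have k: "k \<noteq> \<zero>\<^bsub>K\<^esub>"
    proof
      assume "k = \<zero>\<^bsub>K\<^esub>"
      then have "u = c" using ck CV x by simp
      with u ck C(3) show False by blast
    qed
    then have ik: "inv\<^bsub>K\<^esub> k \<in> carrier K" "inv\<^bsub>K\<^esub> k \<otimes>\<^bsub>K\<^esub> k = \<one>\<^bsub>K\<^esub>"
      using ck(2) K.field_Units by auto
    have "inv\<^bsub>K\<^esub> k \<odot>\<^bsub>V\<^esub> u = inv\<^bsub>K\<^esub> k \<odot>\<^bsub>V\<^esub> c \<oplus>\<^bsub>V\<^esub> x"
      using ck CV x ik V.smult_assoc1[OF ik(1) ck(2) x] by (simp add: V.smult_r_distr)
    then have "x = inv\<^bsub>K\<^esub> k \<odot>\<^bsub>V\<^esub> u \<oplus>\<^bsub>V\<^esub> (\<ominus>\<^bsub>V\<^esub> (inv\<^bsub>K\<^esub> k \<odot>\<^bsub>V\<^esub> c))"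
      using ck(1) CV x ik by (simp add: V.add.m_ac V.r_neg)
    moreover have "inv\<^bsub>K\<^esub> k \<odot>\<^bsub>V\<^esub> u \<in> U" "\<ominus>\<^bsub>V\<^esub> (inv\<^bsub>K\<^esub> k \<odot>\<^bsub>V\<^esub> c) \<in> C"
      using submodule.smult_closed[OF U ik(1) u(1)] submodule.smult_closed[OF C(1) ik(1) ck(1)]
        V.submoduleE(3)[OF C(1)] by auto
    ultimately show ?thesis by blast
  qed
  with C show ?thesis by (rule that)
qed

text \<open>
  Project onto U along a complement that contains W.
\<close>

lemma exists_projection:
  assumes K: "field K" and V: "module K V" and U: "submodule U K V" and W: "submodule W K V"
    and disj: "U \<inter> W = {\<zero>\<^bsub>V\<^esub>}"
  obtains p where "linear_map K V V p" "\<And>x. x \<in> carrier V \<Longrightarrow> p x \<in> U"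
    "\<And>u. u \<in> U \<Longrightarrow> p u = u" "\<And>w. w \<in> W \<Longrightarrow> p w = \<zero>\<^bsub>V\<^esub>"
proof -
  interpret V: module K V by fact
  obtain C where C: "submodule C K V" "W \<subseteq> C" "U \<inter> C = {\<zero>\<^bsub>V\<^esub>}"
    and dec: "\<And>x. x \<in> carrier V \<Longrightarrow> \<exists>u\<in>U. \<exists>c\<in>C. x = u \<oplus>\<^bsub>V\<^esub> c"
    using exists_complement[OF assms] by blast
  note CV = subsetD[OF submodule_subset[OF C(1)]] and UV = subsetD[OF submodule_subset[OF U]]
  obtain p where p: "\<And>x. x \<in> carrier V \<Longrightarrow> p x \<in> U" "\<And>x. x \<in> carrier V \<Longrightarrow> \<exists>c\<in>C. x = p x \<oplus>\<^bsub>V\<^esub> c"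
    using dec by metis
  have uniq: "p (u \<oplus>\<^bsub>V\<^esub> c) = u" if u: "u \<in> U" and c: "c \<in> C" for u c
  proof -
    have x: "u \<oplus>\<^bsub>V\<^esub> c \<in> carrier V" using UV[OF u] CV[OF c] by simp
    obtain d where d: "d \<in> C" "u \<oplus>\<^bsub>V\<^esub> c = p (u \<oplus>\<^bsub>V\<^esub> c) \<oplus>\<^bsub>V\<^esub> d" using p(2)[OF x] by blast
    define q where "q = p (u \<oplus>\<^bsub>V\<^esub> c)"
    have q: "q \<in> U" "q \<in> carrier V" "u \<oplus>\<^bsub>V\<^esub> c = q \<oplus>\<^bsub>V\<^esub> d"
      using p(1)[OF x] UV d(2) by (auto simp: q_def)
    have "\<ominus>\<^bsub>V\<^esub> q \<oplus>\<^bsub>V\<^esub> u = \<ominus>\<^bsub>V\<^esub> q \<oplus>\<^bsub>V\<^esub> ((u \<oplus>\<^bsub>V\<^esub> c) \<oplus>\<^bsub>V\<^esub> \<ominus>\<^bsub>V\<^esub> c)"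
      using UV[OF u] CV[OF c] by (simp add: V.a_assoc V.r_neg)
    also have "\<dots> = d \<oplus>\<^bsub>V\<^esub> \<ominus>\<^bsub>V\<^esub> c"
      unfolding q(3) using q(2) CV[OF c] CV[OF d(1)] by (simp add: V.a_assoc V.r_neg1)
    finally have "\<ominus>\<^bsub>V\<^esub> q \<oplus>\<^bsub>V\<^esub> u = d \<oplus>\<^bsub>V\<^esub> \<ominus>\<^bsub>V\<^esub> c" .
    moreover have "\<ominus>\<^bsub>V\<^esub> q \<oplus>\<^bsub>V\<^esub> u \<in> U"
      by (intro submodule_add[OF U] V.submoduleE(3)[OF U] q u)
    moreover have "d \<oplus>\<^bsub>V\<^esub> \<ominus>\<^bsub>V\<^esub> c \<in> C"
      by (intro submodule_add[OF C(1)] V.submoduleE(3)[OF C(1)] d c)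
    ultimately have "\<ominus>\<^bsub>V\<^esub> q \<oplus>\<^bsub>V\<^esub> u = \<zero>\<^bsub>V\<^esub>" using C(3) by auto
    then have "u = q"
      using V.minus_equality[of "\<ominus>\<^bsub>V\<^esub> q" u] q(2) UV[OF u]
      by (metis V.a_inv_closed V.minus_minus)
    then show ?thesis by (simp add: q_def)
  qed
  have "linear_map K V V p"
    unfolding linear_map_def
  proof (intro conjI ballI)
    show "p v \<in> carrier V" if "v \<in> carrier V" for v using UV p(1) that by blast
    show "p (x \<oplus>\<^bsub>V\<^esub> y) = p x \<oplus>\<^bsub>V\<^esub> p y" if x: "x \<in> carrier V" and y: "y \<in> carrier V" for x y
    proof -
      obtain c d where c: "c \<in> C" "x = p x \<oplus>\<^bsub>V\<^esub> c" and d: "d \<in> C" "y = p y \<oplus>\<^bsub>V\<^esub> d"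
        using p(2) x y by blast
      have "x \<oplus>\<^bsub>V\<^esub> y = (p x \<oplus>\<^bsub>V\<^esub> c) \<oplus>\<^bsub>V\<^esub> (p y \<oplus>\<^bsub>V\<^esub> d)"
        using c(2) d(2) by simp
      also have "\<dots> = (p x \<oplus>\<^bsub>V\<^esub> p y) \<oplus>\<^bsub>V\<^esub> (c \<oplus>\<^bsub>V\<^esub> d)"
        using UV[OF p(1)[OF x]] UV[OF p(1)[OF y]] CV[OF c(1)] CV[OF d(1)] by (simp add: V.add.m_ac)
      finally show ?thesis
        using uniq[of "p x \<oplus>\<^bsub>V\<^esub> p y" "c \<oplus>\<^bsub>V\<^esub> d"] p(1) x y c d submodule_add[OF U] submodule_add[OF C(1)]
        by simp
    qed
    show "p (k \<odot>\<^bsub>V\<^esub> x) = k \<odot>\<^bsub>V\<^esub> p x" if k: "k \<in> carrier K" and x: "x \<in> carrier V" for k x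
    proof -
      obtain c where c: "c \<in> C" "x = p x \<oplus>\<^bsub>V\<^esub> c" using p(2) x by blast
      have "k \<odot>\<^bsub>V\<^esub> x = k \<odot>\<^bsub>V\<^esub> (p x \<oplus>\<^bsub>V\<^esub> c)" using c(2) by simp
      also have "\<dots> = k \<odot>\<^bsub>V\<^esub> p x \<oplus>\<^bsub>V\<^esub> k \<odot>\<^bsub>V\<^esub> c"
        using k UV[OF p(1)[OF x]] CV[OF c(1)] by (simp add: V.smult_r_distr)
      finally show ?thesis
        using uniq[of "k \<odot>\<^bsub>V\<^esub> p x" "k \<odot>\<^bsub>V\<^esub> c"] submodule.smult_closed[OF U k p(1)[OF x]]
          submodule.smult_closed[OF C(1) k c(1)] by simp
    qed
  qed
  moreover have "p u = u" if "u \<in> U" for u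
    using uniq[OF that submodule_zero[OF C(1)]] UV[OF that] by simp
  moreover have "p w = \<zero>\<^bsub>V\<^esub>" if "w \<in> W" for w
    using uniq[OF submodule_zero[OF U], of w] that C(2) CV[of w] by auto
  ultimately show ?thesis using p(1) by (intro that[of p]) auto
qed

text \<open>
  The projection onto the line \<open>K v\<close> that kills W, read off in the coordinate of that line.
\<close>

lemma exists_functional:
  assumes "field K" and V: "module K V" and W: "submodule W K V"
    and v: "v \<in> carrier V" "v \<notin> W"
  obtains l where "linear_map K V (self_alg K) l" "\<And>w. w \<in> W \<Longrightarrow> l w = \<zero>\<^bsub>K\<^esub>" "l v = \<one>\<^bsub>K\<^esub>"
proof -
  interpret K: field K by fact
  interpret V: module K V by fact
  let ?L = "(\<lambda>k. k \<odot>\<^bsub>V\<^esub> v) ` carrier K"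
  have L: "submodule ?L K V" by (rule submodule_line[OF V v(1)])
  have smult_W: "k = \<zero>\<^bsub>K\<^esub>" if k: "k \<in> carrier K" "k \<odot>\<^bsub>V\<^esub> v \<in> W" for k
  proof (rule ccontr)
    assume "k \<noteq> \<zero>\<^bsub>K\<^esub>"
    then have ik: "inv\<^bsub>K\<^esub> k \<in> carrier K" "inv\<^bsub>K\<^esub> k \<otimes>\<^bsub>K\<^esub> k = \<one>\<^bsub>K\<^esub>"
      using k(1) K.field_Units by auto
    have "inv\<^bsub>K\<^esub> k \<odot>\<^bsub>V\<^esub> (k \<odot>\<^bsub>V\<^esub> v) = v"
      using V.smult_assoc1[OF ik(1) k(1) v(1)] ik v(1) by simp
    then show False
      using submodule.smult_closed[OF W ik(1) k(2)] v(2) by simp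
  qed
  have inj: "k = k'" if k: "k \<in> carrier K" "k' \<in> carrier K" "k \<odot>\<^bsub>V\<^esub> v = k' \<odot>\<^bsub>V\<^esub> v" for k k'
  proof -
    have "(k \<ominus>\<^bsub>K\<^esub> k') \<odot>\<^bsub>V\<^esub> v = \<zero>\<^bsub>V\<^esub>"
      using k v(1) by (simp add: a_minus_def V.smult_l_distr V.smult_l_minus V.r_neg)
    then have "k \<ominus>\<^bsub>K\<^esub> k' = \<zero>\<^bsub>K\<^esub>"
      using smult_W[of "k \<ominus>\<^bsub>K\<^esub> k'"] k submodule_zero[OF W] by simp
    then show ?thesis
      using k K.minus_equality[of k "\<ominus>\<^bsub>K\<^esub> k'"] by (simp add: a_minus_def)
  qed
  have "?L \<inter> W = {\<zero>\<^bsub>V\<^esub>}"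
  proof (intro equalityI subsetI)
    show "x \<in> {\<zero>\<^bsub>V\<^esub>}" if x: "x \<in> ?L \<inter> W" for x
    proof -
      obtain k where k: "k \<in> carrier K" "x = k \<odot>\<^bsub>V\<^esub> v" using x by blast
      then have "k = \<zero>\<^bsub>K\<^esub>" using smult_W x by blast
      then show ?thesis using k(2) v(1) by simp
    qed
  qed (use submodule_zero[OF L] submodule_zero[OF W] in blast)
  from exists_projection[OF assms(1) V L W this]
  obtain p where p: "linear_map K V V p" "\<And>x. x \<in> carrier V \<Longrightarrow> p x \<in> ?L"
    "\<And>u. u \<in> ?L \<Longrightarrow> p u = u" "\<And>w. w \<in> W \<Longrightarrow> p w = \<zero>\<^bsub>V\<^esub>"
    by blast
  have "\<forall>x\<in>carrier V. \<exists>k. k \<in> carrier K \<and> p x = k \<odot>\<^bsub>V\<^esub> v" using p(2) by blast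
  then obtain l where l: "\<And>x. x \<in> carrier V \<Longrightarrow> l x \<in> carrier K"
    "\<And>x. x \<in> carrier V \<Longrightarrow> p x = l x \<odot>\<^bsub>V\<^esub> v"
    by metis
  have l_eq: "l x = k" if "x \<in> carrier V" "k \<in> carrier K" "p x = k \<odot>\<^bsub>V\<^esub> v" for x k
    using inj[of "l x" k] l that by simp
  show ?thesis
  proof
    show "linear_map K V (self_alg K) l"
      unfolding linear_map_def self_alg_simps
    proof (intro conjI ballI)
      show "l (x \<oplus>\<^bsub>V\<^esub> y) = l x \<oplus>\<^bsub>K\<^esub> l y" if "x \<in> carrier V" "y \<in> carrier V" for x y
        using that p(1) l v(1) by (intro l_eq) (simp_all add: linear_map_def V.smult_l_distr)
      show "l (k \<odot>\<^bsub>V\<^esub> x) = k \<otimes>\<^bsub>K\<^esub> l x" if "k \<in> carrier K" "x \<in> carrier V" for k x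
        using that p(1) l v(1) by (intro l_eq) (simp_all add: linear_map_def V.smult_assoc1)
    qed (use l in auto)
    show "l w = \<zero>\<^bsub>K\<^esub>" if "w \<in> W" for w
      using that p(4) v(1) submodule_subset[OF W] by (intro l_eq) auto
    show "l v = \<one>\<^bsub>K\<^esub>"
      using v(1) p(3)[OF image_eqI[of v _ "\<one>\<^bsub>K\<^esub>"]] by (intro l_eq) auto
  qed
qed

section \<open>Linear functionals on tensor products\<close>

text \<open>
  This is \<open>l \<otimes> S\<close> followed by the identification of \<open>K \<otimes> S\<close> with S.
\<close>

definition functional_value ::
  "('v \<Rightarrow> 'u) \<Rightarrow> 'u calg \<Rightarrow> ('v, 'u) tensor \<Rightarrow> 'u" where
  "functional_value l S = tensor_lift (add_monoid S) (\<lambda>v s. l v \<odot>\<^bsub>S\<^esub> s)"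

lemma functional_value:
  assumes A: "tensor_product K V S" and l: "linear_map K V (self_alg K) l"
  shows functional_value_closed: "x \<in> carrier (tensor_module K V S) \<Longrightarrow> functional_value l S x \<in> carrier S"
    and functional_value_add:
      "\<lbrakk>x \<in> carrier (tensor_module K V S); y \<in> carrier (tensor_module K V S)\<rbrakk> \<Longrightarrow>
       functional_value l S (x \<oplus>\<^bsub>tensor_module K V S\<^esub> y) = functional_value l S x \<oplus>\<^bsub>S\<^esub> functional_value l S y"
    and functional_value_pure:
      "\<lbrakk>v \<in> carrier V; s \<in> carrier S\<rbrakk> \<Longrightarrow> functional_value l S (pure_tensor K V S v s) = l v \<odot>\<^bsub>S\<^esub> s"
proof -
  interpret A: tensor_product K V S by fact
  have "balanced K V S S (\<lambda>v s. l v \<odot>\<^bsub>S\<^esub> s)"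
    using l unfolding balanced_def linear_map_def
    by (simp add: A.S.smult_l_distr A.S.smult_r_distr A.S.smult_assoc1[symmetric] A.V.R.m_comm)
  note * = A.tensor_lift_add_monoid[OF A.S.abelian_group_axioms this, folded functional_value_def]
  show "x \<in> carrier A.X \<Longrightarrow> functional_value l S x \<in> carrier S"
    "\<lbrakk>x \<in> carrier A.X; y \<in> carrier A.X\<rbrakk> \<Longrightarrow>
       functional_value l S (x \<oplus>\<^bsub>A.X\<^esub> y) = functional_value l S x \<oplus>\<^bsub>S\<^esub> functional_value l S y"
    "\<lbrakk>v \<in> carrier V; s \<in> carrier S\<rbrakk> \<Longrightarrow> functional_value l S (pure_tensor K V S v s) = l v \<odot>\<^bsub>S\<^esub> s"
    by (rule *; assumption)+
qed

lemma functional_value_smult: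
  assumes A: "tensor_product K V S" and l: "linear_map K V (self_alg K) l"
    and s: "s \<in> carrier S" and x: "x \<in> carrier (tensor_module K V S)"
  shows "functional_value l S (s \<odot>\<^bsub>tensor_module K V S\<^esub> x) = s \<otimes>\<^bsub>S\<^esub> functional_value l S x"
proof -
  interpret A: tensor_product K V S by fact
  have lv: "l v \<in> carrier K" if "v \<in> carrier V" for v using l that by (simp add: linear_map_def)
  note fv = functional_value[OF A l]
  show ?thesis
    using x
  proof (induction rule: A.tensor_induct)
    case (pure v t)
    then have "l v \<odot>\<^bsub>S\<^esub> (s \<otimes>\<^bsub>S\<^esub> t) = s \<otimes>\<^bsub>S\<^esub> (l v \<odot>\<^bsub>S\<^esub> t)"
      using A.S.smult_assoc2[OF lv[OF pure(1)] pure(2) s] s lv A.S.m_comm by simp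
    with pure show ?case using s by (simp add: fv A.smult_pure)
  next
    case (add x y)
    then show ?case using s by (simp add: fv A.smult_add A.smult_closed A.S.r_distr)
  qed
qed

lemma functional_value_natural:
  assumes A: "tensor_product K V S" and B: "tensor_product K V T" and l: "linear_map K V (self_alg K) l"
    and \<phi>: "\<phi> \<in> alg_hom K S T" and x: "x \<in> carrier (tensor_module K V S)"
  shows "functional_value l T (tensor_map K V T (\<lambda>v. v) \<phi> x) = \<phi> (functional_value l S x)"
proof -
  interpret A: tensor_product K V S by fact
  interpret B: tensor_product K V T by fact
  have lv: "l v \<in> carrier K" if "v \<in> carrier V" for v using l that by (simp add: linear_map_def)
  note tm = tensor_map[OF A B linear_map_identity linear_map_alg_hom[OF \<phi>]]
  show ?thesis
    using x
    by (induction rule: A.tensor_induct)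
       (simp_all add: tm functional_value[OF A l] functional_value[OF B l] alg_homD[OF \<phi>] lv
         ring_hom_add[OF alg_homD(1)[OF \<phi>]])
qed

section \<open>Functionals separate the points of a tensor product\<close>

text \<open>
  The submodule \<open>W \<otimes> S\<close> of \<open>V \<otimes> S\<close>, as an image because the two tensor products consist of cosets
  in different free abelian groups.
\<close>

definition tensor_span ::
  "'u ring \<Rightarrow> ('u, 'v) module \<Rightarrow> 'u calg \<Rightarrow> 'v set \<Rightarrow> ('v, 'u) tensor set" where
  "tensor_span K V S W = qc_inclusion K V S ` carrier (tensor_module K (V\<lparr>carrier := W\<rparr>) S)"

context tensor_product
begin

lemma qc_inclusion:
  assumes W: "submodule W K V"
  shows qc_inclusion_closed: "x \<in> carrier (tensor_module K (V\<lparr>carrier := W\<rparr>) S) \<Longrightarrow> qc_inclusion K V S x \<in> carrier X"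
    and qc_inclusion_add: "\<lbrakk>x \<in> carrier (tensor_module K (V\<lparr>carrier := W\<rparr>) S); y \<in> carrier (tensor_module K (V\<lparr>carrier := W\<rparr>) S)\<rbrakk> \<Longrightarrow>
      qc_inclusion K V S (x \<oplus>\<^bsub>tensor_module K (V\<lparr>carrier := W\<rparr>) S\<^esub> y) = qc_inclusion K V S x \<oplus>\<^bsub>X\<^esub> qc_inclusion K V S y"
    and qc_inclusion_pure: "\<lbrakk>w \<in> W; s \<in> carrier S\<rbrakk> \<Longrightarrow> qc_inclusion K V S (pure_tensor K (V\<lparr>carrier := W\<rparr>) S w s) = w \<otimes>\<^sub>t s"
proof -
  have W': "tensor_product K (V\<lparr>carrier := W\<rparr>) S"
    by (intro tensor_productI submodule.submodule_is_module[OF W] V.module_axioms S.algebra_axioms)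
  note * = tensor_map[OF W' tensor_product_axioms linear_map_inclusion[OF W] linear_map_identity,
      folded qc_inclusion_eq_tensor_map]
  show "x \<in> carrier (tensor_module K (V\<lparr>carrier := W\<rparr>) S) \<Longrightarrow> qc_inclusion K V S x \<in> carrier X"
    "\<lbrakk>x \<in> carrier (tensor_module K (V\<lparr>carrier := W\<rparr>) S); y \<in> carrier (tensor_module K (V\<lparr>carrier := W\<rparr>) S)\<rbrakk> \<Longrightarrow>
      qc_inclusion K V S (x \<oplus>\<^bsub>tensor_module K (V\<lparr>carrier := W\<rparr>) S\<^esub> y) = qc_inclusion K V S x \<oplus>\<^bsub>X\<^esub> qc_inclusion K V S y"
    "\<lbrakk>w \<in> W; s \<in> carrier S\<rbrakk> \<Longrightarrow> qc_inclusion K V S (pure_tensor K (V\<lparr>carrier := W\<rparr>) S w s) = w \<otimes>\<^sub>t s"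
    by (rule *; simp)+
qed

lemma tensor_span_pure:
  assumes W: "submodule W K V" and "w \<in> W" "s \<in> carrier S"
  shows "w \<otimes>\<^sub>t s \<in> tensor_span K V S W"
proof -
  interpret W: tensor_product K "V\<lparr>carrier := W\<rparr>" S
    by (intro tensor_productI submodule.submodule_is_module[OF W] V.module_axioms S.algebra_axioms)
  show ?thesis
    unfolding tensor_span_def
    by (rule image_eqI[where x = "W.pure w s"])
       (use assms in \<open>simp_all add: qc_inclusion_pure[OF W]\<close>)
qed

lemma tensor_span_add:
  assumes W: "submodule W K V" and xy: "x \<in> tensor_span K V S W" "y \<in> tensor_span K V S W"
  shows "x \<oplus>\<^bsub>X\<^esub> y \<in> tensor_span K V S W"
proof -
  interpret W: tensor_product K "V\<lparr>carrier := W\<rparr>" S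
    by (intro tensor_productI submodule.submodule_is_module[OF W] V.module_axioms S.algebra_axioms)
  show ?thesis
    using xy unfolding tensor_span_def
    by (elim imageE) (auto intro!: imageI W.X.a_closed simp flip: qc_inclusion_add[OF W])
qed

lemma tensor_span_subset:
  "submodule W K V \<Longrightarrow> tensor_span K V S W \<subseteq> carrier X"
  unfolding tensor_span_def using qc_inclusion_closed by blast

lemma tensor_span_induct [consumes 2, case_names pure add]:
  assumes W: "submodule W K V" and x: "x \<in> tensor_span K V S W"
    and pure: "\<And>w s. w \<in> W \<Longrightarrow> s \<in> carrier S \<Longrightarrow> P (w \<otimes>\<^sub>t s)"
    and add: "\<And>x y. \<lbrakk>x \<in> tensor_span K V S W; y \<in> tensor_span K V S W; P x; P y\<rbrakk> \<Longrightarrow> P (x \<oplus>\<^bsub>X\<^esub> y)"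
  shows "P x"
proof -
  interpret W: tensor_product K "V\<lparr>carrier := W\<rparr>" S
    by (intro tensor_productI submodule.submodule_is_module[OF W] V.module_axioms S.algebra_axioms)
  obtain y where y: "y \<in> carrier W.X" "x = qc_inclusion K V S y"
    using x unfolding tensor_span_def by blast
  have "P (qc_inclusion K V S y)"
    using y(1)
  proof (induction rule: W.tensor_induct)
    case (pure v s)
    then show ?case using assms(3) by (simp add: qc_inclusion_pure[OF W])
  next
    case (add x y)
    then show ?case
      using assms(4) by (simp add: qc_inclusion_add[OF W] tensor_span_def)
  qed
  then show ?thesis using y(2) by simp
qed

lemma functional_value_tensor_span:
  assumes W: "submodule W K V" and l: "linear_map K V (self_alg K) l" "\<And>w. w \<in> W \<Longrightarrow> l w = \<zero>\<^bsub>K\<^esub>"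
    and x: "x \<in> tensor_span K V S W"
  shows "functional_value l S x = \<zero>\<^bsub>S\<^esub>"
  using W x
proof (induction rule: tensor_span_induct)
  case (pure w s)
  then show ?case
    using l(2) submodule_subset[OF W] by (auto simp: functional_value_pure[OF tensor_product_axioms l(1)])
next
  case (add x y)
  then show ?case
    using subsetD[OF tensor_span_subset[OF W]] by (simp add: functional_value_add[OF tensor_product_axioms l(1)])
qed

text \<open>
  Inside the span of \<open>W'\<close>, the functionals that vanish on W cut out the span of W.  The case of interest
  is \<open>W' = V\<close>; stating it for a pair of submodules makes it transitive, so that \<open>W'\<close> can be reached
  from W by adding one line at a time.
\<close>

definition separated :: "'v set \<Rightarrow> 'v set \<Rightarrow> bool" where
  "separated W' W \<longleftrightarrow> (\<forall>x\<in>tensor_span K V S W'.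
     (\<forall>l. linear_map K V (self_alg K) l \<and> (\<forall>w\<in>W. l w = \<zero>\<^bsub>K\<^esub>) \<longrightarrow> functional_value l S x = \<zero>\<^bsub>S\<^esub>) \<longrightarrow>
     x \<in> tensor_span K V S W)"

lemma separated_trans:
  "W \<subseteq> W' \<Longrightarrow> separated W'' W' \<Longrightarrow> separated W' W \<Longrightarrow> separated W'' W"
  unfolding separated_def by blast

text \<open>
  An element of the span of \<open>W + K v\<close> has the form \<open>y + v \<otimes> t\<close> with y in the span of W.  If v is not
  in W, a functional that kills W and takes the value 1 at v maps this element to t; so \<open>t = 0\<close>.
\<close>

lemma separated_add_line:
  assumes K: "field K" and W: "submodule W K V" and v: "v \<in> carrier V"
  shows "separated {w \<oplus>\<^bsub>V\<^esub> u | w u. w \<in> W \<and> u \<in> (\<lambda>k. k \<odot>\<^bsub>V\<^esub> v) ` carrier K} W"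
    (is "separated ?D W")
  unfolding separated_def
proof (intro ballI impI)
  have D: "submodule ?D K V"
    by (intro submodule_sum submodule_line W v V.module_axioms)
  note WV = subsetD[OF submodule_subset[OF W]]
  note span = subsetD[OF tensor_span_subset[OF W]]
  fix x assume x: "x \<in> tensor_span K V S ?D"
    and kill: "\<forall>l. linear_map K V (self_alg K) l \<and> (\<forall>w\<in>W. l w = \<zero>\<^bsub>K\<^esub>) \<longrightarrow> functional_value l S x = \<zero>\<^bsub>S\<^esub>"
  have "\<exists>y\<in>tensor_span K V S W. \<exists>t\<in>carrier S. x = y \<oplus>\<^bsub>X\<^esub> v \<otimes>\<^sub>t t"
    using D x
  proof (induction rule: tensor_span_induct)
    case (pure d s)
    then obtain w k where wk: "w \<in> W" "k \<in> carrier K" "d = w \<oplus>\<^bsub>V\<^esub> k \<odot>\<^bsub>V\<^esub> v" by blast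
    then have "d \<otimes>\<^sub>t s = w \<otimes>\<^sub>t s \<oplus>\<^bsub>X\<^esub> v \<otimes>\<^sub>t (k \<odot>\<^bsub>S\<^esub> s)"
      using pure(2) WV v by (simp add: pure_add_left pure_smult)
    then show ?case
      using tensor_span_pure[OF W wk(1) pure(2)] S.smult_closed[OF wk(2) pure(2)] by blast
  next
    case (add x y)
    then obtain x' y' s t where *: "x' \<in> tensor_span K V S W" "y' \<in> tensor_span K V S W"
      "s \<in> carrier S" "t \<in> carrier S" "x = x' \<oplus>\<^bsub>X\<^esub> v \<otimes>\<^sub>t s" "y = y' \<oplus>\<^bsub>X\<^esub> v \<otimes>\<^sub>t t"
      by blast
    then have "x \<oplus>\<^bsub>X\<^esub> y = (x' \<oplus>\<^bsub>X\<^esub> y') \<oplus>\<^bsub>X\<^esub> v \<otimes>\<^sub>t (s \<oplus>\<^bsub>S\<^esub> t)"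
      using span v by (simp add: pure_add_right X.add.m_ac)
    then show ?case
      using tensor_span_add[OF W *(1,2)] S.M.a_closed[OF *(3,4)] by blast
  qed
  then obtain y t where y: "y \<in> tensor_span K V S W" and t: "t \<in> carrier S" and xy: "x = y \<oplus>\<^bsub>X\<^esub> v \<otimes>\<^sub>t t"
    by blast
  show "x \<in> tensor_span K V S W"
  proof (cases "v \<in> W")
    case True
    then show ?thesis
      unfolding xy by (intro tensor_span_add[OF W y] tensor_span_pure[OF W _ t])
  next
    case False
    obtain l where l: "linear_map K V (self_alg K) l" "\<And>w. w \<in> W \<Longrightarrow> l w = \<zero>\<^bsub>K\<^esub>" "l v = \<one>\<^bsub>K\<^esub>"
      using exists_functional[OF K V.module_axioms W v False] by blast
    have "functional_value l S x = t"
      using t v span[OF y] functional_value_tensor_span[OF W l(1,2) y] unfolding xy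
      by (simp add: functional_value[OF tensor_product_axioms l(1)] l(3))
    then have "t = \<zero>\<^bsub>S\<^esub>" using kill l by metis
    then show ?thesis using y span[OF y] v unfolding xy by simp
  qed
qed

text \<open>
  Any x is a finite sum of pure tensors, so it lies in the span of a submodule obtained from W by
  adding finitely many lines, and \<open>separated_add_line\<close> removes these one by one.  The induction
  on x lets W vary, because the lines for the second summand are added on top of those for the
  first.
\<close>

proposition tensor_span_separation:
  assumes K: "field K" and W: "submodule W K V" and x: "x \<in> carrier X"
    and kill: "\<And>l. linear_map K V (self_alg K) l \<Longrightarrow> (\<And>w. w \<in> W \<Longrightarrow> l w = \<zero>\<^bsub>K\<^esub>) \<Longrightarrow> functional_value l S x = \<zero>\<^bsub>S\<^esub>"
  shows "x \<in> tensor_span K V S W"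
proof -
  have "\<forall>W. submodule W K V \<longrightarrow> (\<exists>W'. submodule W' K V \<and> W \<subseteq> W' \<and> x \<in> tensor_span K V S W' \<and> separated W' W)"
    using x
  proof (induction rule: tensor_induct)
    case (pure v s)
    show ?case
    proof (intro allI impI)
      fix W assume W: "submodule W K V"
      let ?D = "{w \<oplus>\<^bsub>V\<^esub> u | w u. w \<in> W \<and> u \<in> (\<lambda>k. k \<odot>\<^bsub>V\<^esub> v) ` carrier K}"
      have L: "submodule ((\<lambda>k. k \<odot>\<^bsub>V\<^esub> v) ` carrier K) K V"
        by (rule submodule_line[OF V.module_axioms pure(1)])
      have D: "submodule ?D K V"
        by (rule submodule_sum[OF V.module_axioms W L])
      have "w \<in> ?D" if "w \<in> W" for w
        using that submodule_zero[OF L] V.r_zero subsetD[OF submodule_subset[OF W] that] by force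
      moreover have "v \<in> ?D"
      proof -
        have "v \<in> (\<lambda>k. k \<odot>\<^bsub>V\<^esub> v) ` carrier K"
          using pure(1) by (intro image_eqI[of _ _ "\<one>\<^bsub>K\<^esub>"]) auto
        then show ?thesis using submodule_zero[OF W] V.l_zero[OF pure(1)] by force
      qed
      ultimately show "\<exists>W'. submodule W' K V \<and> W \<subseteq> W' \<and> v \<otimes>\<^sub>t s \<in> tensor_span K V S W' \<and> separated W' W"
        using D tensor_span_pure[OF D _ pure(2)] separated_add_line[OF K W pure(1)]
        by (intro exI[of _ ?D]) blast
    qed
  next
    case (add x y)
    show ?case
    proof (intro allI impI)
      fix W assume "submodule W K V"
      then obtain W' where W': "submodule W' K V" "W \<subseteq> W'" "x \<in> tensor_span K V S W'" "separated W' W"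
        using add by blast
      then obtain W'' where W'': "submodule W'' K V" "W' \<subseteq> W''" "y \<in> tensor_span K V S W''" "separated W'' W'"
        using add by blast
      have "z \<in> tensor_span K V S W''" if "z \<in> tensor_span K V S W'" for z
        using W'(1) that
        by (induction rule: tensor_span_induct)
           (use W''(2) tensor_span_pure[OF W''(1)] tensor_span_add[OF W''(1)] in auto)
      then have "x \<oplus>\<^bsub>X\<^esub> y \<in> tensor_span K V S W''"
        using W'(3) W''(3) tensor_span_add[OF W''(1)] by blast
      moreover have "separated W'' W"
        by (rule separated_trans[OF W'(2) W''(4) W'(4)])
      ultimately show "\<exists>W'. submodule W' K V \<and> W \<subseteq> W' \<and> x \<oplus>\<^bsub>X\<^esub> y \<in> tensor_span K V S W' \<and> separated W' W"
        using W''(1,2) W'(2) by blast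
    qed
  qed
  then obtain W' where "x \<in> tensor_span K V S W'" "separated W' W" using W by blast
  then show ?thesis using kill unfolding separated_def by blast
qed

text \<open>
  Over a field W has a linear retraction \<open>V \<rightarrow> W\<close>; tensored with S, it is a left inverse of the
  inclusion.
\<close>

proposition inj_on_qc_inclusion:
  assumes K: "field K" and W: "submodule W K V"
  shows "inj_on (qc_inclusion K V S) (carrier (tensor_module K (V\<lparr>carrier := W\<rparr>) S))"
proof -
  let ?W = "V\<lparr>carrier := W\<rparr>"
  interpret W: tensor_product K ?W S
    by (intro tensor_productI submodule.submodule_is_module[OF W] V.module_axioms S.algebra_axioms)
  have "submodule {\<zero>\<^bsub>V\<^esub>} K V"
    by (rule V.submoduleI) (auto simp: V.minus_equality)
  moreover have "W \<inter> {\<zero>\<^bsub>V\<^esub>} = {\<zero>\<^bsub>V\<^esub>}" using submodule_zero[OF W] by blast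
  ultimately obtain p where p: "linear_map K V V p" "\<And>x. x \<in> carrier V \<Longrightarrow> p x \<in> W" "\<And>u. u \<in> W \<Longrightarrow> p u = u"
    using exists_projection[OF K V.module_axioms W] by metis
  have p': "linear_map K V ?W p" using p by (simp add: linear_map_def)
  have "tensor_map K ?W S (\<lambda>v. v) (\<lambda>s. s) x = tensor_map K ?W S p (\<lambda>s. s) (qc_inclusion K V S x)"
    if "x \<in> carrier W.X" for x
    unfolding qc_inclusion_eq_tensor_map
    by (rule tensor_map_compose[OF W.tensor_product_axioms tensor_product_axioms W.tensor_product_axioms
          linear_map_inclusion[OF W] linear_map_identity p' linear_map_identity linear_map_identity _
          linear_map_identity refl that]) (simp add: p(3))
  then have "tensor_map K ?W S p (\<lambda>s. s) (qc_inclusion K V S x) = x" if "x \<in> carrier W.X" for x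
    using that tensor_map_id[OF W.tensor_product_axioms linear_map_identity refl linear_map_identity refl that]
    by simp
  then show ?thesis by (rule inj_on_inverseI)
qed

end

context tensor_product
begin

lemma subgroup_tensor_span:
  assumes W: "submodule W K V"
  shows "subgroup (tensor_span K V S W) (add_monoid X)"
proof (rule X.add.subgroupI)
  have WV: "v \<in> carrier V" if "v \<in> W" for v using submodule_subset[OF W] that by blast
  show "tensor_span K V S W \<subseteq> carrier X" by (rule tensor_span_subset[OF W])
  show "tensor_span K V S W \<noteq> {}"
    using tensor_span_pure[OF W submodule_zero[OF W], of "\<zero>\<^bsub>S\<^esub>"] by auto
  show "\<ominus>\<^bsub>X\<^esub> x \<in> tensor_span K V S W" if "x \<in> tensor_span K V S W" for x
    using W that
  proof (induction rule: tensor_span_induct)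
    case (pure w s)
    then show ?case
      using tensor_span_pure[OF W V.submoduleE(3)[OF W pure(1)] pure(2)] WV by (simp add: pure_minus)
  next
    case (add x y)
    then show ?case
      using subsetD[OF tensor_span_subset[OF W]] by (simp add: X.minus_add tensor_span_add[OF W])
  qed
qed (rule tensor_span_add[OF W])

lemma tensor_span_smult:
  assumes W: "submodule W K V" and s: "s \<in> carrier S" and x: "x \<in> tensor_span K V S W"
  shows "s \<odot>\<^bsub>X\<^esub> x \<in> tensor_span K V S W"
  using W x
proof (induction rule: tensor_span_induct)
  case (pure w t)
  then show ?case
    using s subsetD[OF submodule_subset[OF W]] by (simp add: smult_pure tensor_span_pure[OF W])
next
  case (add x y)
  then show ?case
    using s subsetD[OF tensor_span_subset[OF W]] by (simp add: smult_add tensor_span_add[OF W])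
qed

lemma tensor_span_zero:
  assumes "submodule {\<zero>\<^bsub>V\<^esub>} K V" and "x \<in> tensor_span K V S {\<zero>\<^bsub>V\<^esub>}"
  shows "x = \<zero>\<^bsub>X\<^esub>"
  using assms by (induction rule: tensor_span_induct) simp_all

lemma pure_eq_smult: "v \<in> carrier V \<Longrightarrow> s \<in> carrier S \<Longrightarrow> v \<otimes>\<^sub>t s = s \<odot>\<^bsub>X\<^esub> (v \<otimes>\<^sub>t \<one>\<^bsub>S\<^esub>)"
  by (simp add: smult_pure)

end

section \<open>The canonical identification of V with its tensor product by K\<close>

lemma tensor_product_self_alg: "module K V \<Longrightarrow> tensor_product K V (self_alg K)"
  by (intro tensor_productI algebra_self_alg) (simp_all add: module_def)

text \<open>
  The map \<open>v \<otimes> k \<mapsto> k \<cdot> v\<close> is a left inverse.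
\<close>

lemma inj_on_point_tensor:
  assumes "module K V"
  shows "inj_on (point_tensor K V) (carrier V)"
proof -
  interpret V: module K V by fact
  interpret A: tensor_product K V "self_alg K" by (rule tensor_product_self_alg[OF assms])
  have "balanced K V (self_alg K) V (\<lambda>v k. k \<odot>\<^bsub>V\<^esub> v)"
    by (simp add: balanced_def V.smult_r_distr V.smult_l_distr V.R.m_comm flip: V.smult_assoc1)
  then have "tensor_lift (add_monoid V) (\<lambda>v k. k \<odot>\<^bsub>V\<^esub> v) (point_tensor K V v) = v"
    if "v \<in> carrier V" for v
    using that by (simp add: point_tensor_def A.tensor_lift_add_monoid[OF V.abelian_group_axioms])
  then show ?thesis by (rule inj_on_inverseI)
qed

lemma point_tensor_image:
  assumes "module K V"
  shows "point_tensor K V ` carrier V = carrier (tensor_module K V (self_alg K))"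
proof (intro equalityI subsetI)
  interpret V: module K V by fact
  interpret A: tensor_product K V "self_alg K" by (rule tensor_product_self_alg[OF assms])
  show "x \<in> carrier A.X" if "x \<in> point_tensor K V ` carrier V" for x
    using that by (auto simp: point_tensor_def)
  show "x \<in> point_tensor K V ` carrier V" if "x \<in> carrier A.X" for x
    using that
  proof (induction rule: A.tensor_induct)
    case (pure v k)
    then show ?case
      using A.pure_smult[of k v "\<one>\<^bsub>K\<^esub>"] by (intro image_eqI[of _ _ "k \<odot>\<^bsub>V\<^esub> v"]) (simp_all add: point_tensor_def)
  next
    case (add x y)
    then show ?case
      by (auto simp: point_tensor_def simp flip: A.pure_add_left)
  qed
qed

lemma tensor_span_self_alg:
  assumes V: "module K V" and W: "submodule W K V"
  shows "tensor_span K V (self_alg K) W = point_tensor K V ` W"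
proof -
  interpret A: tensor_product K V "self_alg K" by (rule tensor_product_self_alg[OF V])
  have "qc_inclusion K V (self_alg K) (point_tensor K (V\<lparr>carrier := W\<rparr>) w) = point_tensor K V w" if "w \<in> W" for w
    unfolding point_tensor_def using that by (intro A.qc_inclusion_pure[OF W]) auto
  then have "qc_inclusion K V (self_alg K) ` point_tensor K (V\<lparr>carrier := W\<rparr>) ` W = point_tensor K V ` W"
    unfolding image_image by (rule image_cong[OF refl])
  then show ?thesis
    using point_tensor_image[OF submodule.submodule_is_module[OF W V]]
    unfolding tensor_span_def by simp
qed

section \<open>Morphisms out of a D-proquasi-coherent module\<close>

lemma K_module_functorD:
  assumes "K_module_functor K F"
  shows "algebra K S \<Longrightarrow> module S (fobj F S)"
    and "\<lbrakk>algebra K S; algebra K T; \<phi> \<in> alg_hom K S T; x \<in> carrier (fobj F S)\<rbrakk> \<Longrightarrow>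
      fmap F S T \<phi> x \<in> carrier (fobj F T)"
    and "\<lbrakk>algebra K S; algebra K T; \<phi> \<in> alg_hom K S T; x \<in> carrier (fobj F S); y \<in> carrier (fobj F S)\<rbrakk> \<Longrightarrow>
      fmap F S T \<phi> (x \<oplus>\<^bsub>fobj F S\<^esub> y) = fmap F S T \<phi> x \<oplus>\<^bsub>fobj F T\<^esub> fmap F S T \<phi> y"
    and "\<lbrakk>algebra K S; algebra K T; \<phi> \<in> alg_hom K S T; s \<in> carrier S; x \<in> carrier (fobj F S)\<rbrakk> \<Longrightarrow>
      fmap F S T \<phi> (s \<odot>\<^bsub>fobj F S\<^esub> x) = \<phi> s \<odot>\<^bsub>fobj F T\<^esub> fmap F S T \<phi> x"
  using assms unfolding K_module_functor_def by blast+

lemma K_module_morphismD: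
  assumes "K_module_morphism K F G f" and "algebra K S"
  shows "x \<in> carrier (fobj F S) \<Longrightarrow> f S x \<in> carrier (fobj G S)"
    and "\<lbrakk>x \<in> carrier (fobj F S); y \<in> carrier (fobj F S)\<rbrakk> \<Longrightarrow>
      f S (x \<oplus>\<^bsub>fobj F S\<^esub> y) = f S x \<oplus>\<^bsub>fobj G S\<^esub> f S y"
    and "\<lbrakk>s \<in> carrier S; x \<in> carrier (fobj F S)\<rbrakk> \<Longrightarrow>
      f S (s \<odot>\<^bsub>fobj F S\<^esub> x) = s \<odot>\<^bsub>fobj G S\<^esub> f S x"
    and "\<lbrakk>algebra K T; \<phi> \<in> alg_hom K S T; x \<in> carrier (fobj F S)\<rbrakk> \<Longrightarrow>
      f T (fmap F S T \<phi> x) = fmap G S T \<phi> (f S x)"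
  using assms unfolding K_module_morphism_def by blast+

lemma restrict_scalars_simps [simp]:
  "carrier (restrict_scalars S T) = carrier T" "monoid.mult (restrict_scalars S T) = monoid.mult T"
  "one (restrict_scalars S T) = one T" "ring.add (restrict_scalars S T) = ring.add T"
  "ring.zero (restrict_scalars S T) = ring.zero T"
  "smult (restrict_scalars S T) = (\<lambda>k t. (k \<odot>\<^bsub>S\<^esub> \<one>\<^bsub>S\<^esub>) \<odot>\<^bsub>T\<^esub> t)"
  by (simp_all add: restrict_scalars_def)

text \<open>
  Restriction of scalars along the identity of K changes nothing but the scalar multiplication, in
  which \<open>k \<cdot> 1\<close> replaces k.  The two are equal on the carrier of K but may differ off it, so T and
  its restriction are isomorphic through the identity map but possibly different records; hence the transport in \<open>alg_hom_to_restrict_scalars\<close>.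
\<close>

lemma algebra_restrict_scalars:
  assumes "algebra K T"
  shows "algebra K (restrict_scalars (self_alg K) T)" (is "algebra K ?R")
proof -
  interpret T: algebra K T by fact
  have "cring ?R"
  proof (rule cringI)
    show "abelian_group ?R"
    proof (rule abelian_groupI)
      show "\<exists>y\<in>carrier ?R. y \<oplus>\<^bsub>?R\<^esub> x = \<zero>\<^bsub>?R\<^esub>" if "x \<in> carrier ?R" for x
        using that T.M.l_neg[of x] by (intro bexI[of _ "\<ominus>\<^bsub>T\<^esub> x"]) auto
    qed (auto simp: T.M.a_ac)
    show "comm_monoid ?R"
      by (rule comm_monoidI) (auto simp: T.m_ac)
  qed (simp add: T.l_distr)
  then show ?thesis
    using T.R_cring
    by (intro algebraI) (simp_all add: T.smult_l_distr T.smult_r_distr T.smult_assoc1 T.smult_assoc2)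
qed

lemma alg_hom_restrict_scalars:
  assumes "cring K" and "\<phi> \<in> alg_hom (self_alg K) T U"
  shows "\<phi> \<in> alg_hom K (restrict_scalars (self_alg K) T) (restrict_scalars (self_alg K) U)"
proof -
  interpret cring K by fact
  show ?thesis using assms(2) by (simp add: alg_hom_def ring_hom_def)
qed

lemma alg_hom_to_restrict_scalars:
  assumes "algebra K T"
  shows "(\<lambda>t\<in>carrier T. t) \<in> alg_hom K T (restrict_scalars (self_alg K) T)"
proof -
  interpret T: algebra K T by fact
  show ?thesis by (auto simp: alg_hom_def ring_hom_def)
qed

lemma module_self_alg_iff:
  assumes "cring K"
  shows "module (self_alg K) X \<longleftrightarrow> module K X"
proof -
  have c: "cring (self_alg K)" using algebra.M_cring[OF algebra_self_alg[OF assms]] .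
  show ?thesis
    using assms c by (simp add: module_def module_axioms_def)
qed

lemma ring_hom_zero_alg: "algebra K S \<Longrightarrow> algebra K T \<Longrightarrow> \<phi> \<in> alg_hom K S T \<Longrightarrow> \<phi> \<zero>\<^bsub>S\<^esub> = \<zero>\<^bsub>T\<^esub>"
  using ring_hom_zero[of \<phi> S T] by (simp add: alg_homD(1) algebra.M_cring cring.axioms(1))

text \<open>
  The map \<open>(m, s) \<mapsto> s \<cdot> m\<close> is balanced because base change along \<open>K \<rightarrow> S\<close> turns the scalar k into
  its image in S, which can be moved to s.
\<close>

lemma from_points:
  assumes "cring K" and F: "K_module_functor K F" and S: "algebra K S"
  defines "P \<equiv> tensor_module K (fobj F (self_alg K)) S"
  shows from_points_closed: "x \<in> carrier P \<Longrightarrow> from_points K F S x \<in> carrier (fobj F S)"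
    and from_points_add: "\<lbrakk>x \<in> carrier P; y \<in> carrier P\<rbrakk> \<Longrightarrow>
      from_points K F S (x \<oplus>\<^bsub>P\<^esub> y) = from_points K F S x \<oplus>\<^bsub>fobj F S\<^esub> from_points K F S y"
    and from_points_pure: "\<lbrakk>m \<in> carrier (fobj F (self_alg K)); s \<in> carrier S\<rbrakk> \<Longrightarrow>
      from_points K F S (pure_tensor K (fobj F (self_alg K)) S m s) =
      s \<odot>\<^bsub>fobj F S\<^esub> fmap F (self_alg K) S (struct_map K S) m"
proof -
  let ?K = "self_alg K"
  have K: "algebra K ?K" by (rule algebra_self_alg[OF assms(1)])
  have \<sigma>: "struct_map K S \<in> alg_hom K ?K S" by (rule struct_map_alg_hom[OF S])
  note FD = K_module_functorD[OF F]
  have "module K (fobj F ?K)"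
    using FD(1)[OF K] module_self_alg_iff[OF assms(1)] by blast
  then interpret A: tensor_product K "fobj F ?K" S
    by (rule tensor_productI[OF _ S])
  interpret FS: module S "fobj F S" by (rule FD(1)[OF S])
  have "balanced K (fobj F ?K) S (fobj F S) (\<lambda>m s. s \<odot>\<^bsub>fobj F S\<^esub> fmap F ?K S (struct_map K S) m)"
    unfolding balanced_def
  proof (intro conjI ballI)
    fix k m s assume k: "k \<in> carrier K" and m: "m \<in> carrier (fobj F ?K)" and s: "s \<in> carrier S"
    have st: "struct_map K S k \<in> carrier S" using alg_homD(2)[OF \<sigma>] k by simp
    have "s \<otimes>\<^bsub>S\<^esub> struct_map K S k = k \<odot>\<^bsub>S\<^esub> s"
      using k s A.S.m_comm[OF s st] by (simp add: struct_map_def A.S.smult_assoc2)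
    then show "s \<odot>\<^bsub>fobj F S\<^esub> fmap F ?K S (struct_map K S) (k \<odot>\<^bsub>fobj F ?K\<^esub> m) =
        (k \<odot>\<^bsub>S\<^esub> s) \<odot>\<^bsub>fobj F S\<^esub> fmap F ?K S (struct_map K S) m"
      using FD(4)[OF K S \<sigma>, of k m] FD(2)[OF K S \<sigma> m] k m s st FS.smult_assoc1[OF s st] by simp
  qed (simp_all add: FD(2,3)[OF K S \<sigma>] FS.smult_l_distr FS.smult_r_distr)
  note * = A.tensor_lift_add_monoid[OF FS.M.abelian_group_axioms this, folded from_points_def P_def]
  show "x \<in> carrier P \<Longrightarrow> from_points K F S x \<in> carrier (fobj F S)"
    "\<lbrakk>x \<in> carrier P; y \<in> carrier P\<rbrakk> \<Longrightarrow>
      from_points K F S (x \<oplus>\<^bsub>P\<^esub> y) = from_points K F S x \<oplus>\<^bsub>fobj F S\<^esub> from_points K F S y"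
    "\<lbrakk>m \<in> carrier (fobj F (self_alg K)); s \<in> carrier S\<rbrakk> \<Longrightarrow>
      from_points K F S (pure_tensor K (fobj F (self_alg K)) S m s) =
      s \<odot>\<^bsub>fobj F S\<^esub> fmap F (self_alg K) S (struct_map K S) m"
    by (rule *; assumption)+
qed

text \<open>
  A natural family of maps \<open>g S : F(S) \<rightarrow> S\<close>, indexed by K-algebras, in the extensional form that
  elements of \<open>F\<^sup>*(K)\<close> have: over the K-algebras T viewed as algebras over \<open>self_alg K\<close>.
\<close>

definition functional_family ::
  "'u ring \<Rightarrow> ('u, 'x) mod_functor \<Rightarrow> ('u calg \<Rightarrow> 'x \<Rightarrow> 'u) \<Rightarrow> 'u calg \<Rightarrow> 'x \<Rightarrow> 'u" where
  "functional_family K F g = (\<lambda>T\<in>{T. algebra (self_alg K) T}.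
     \<lambda>x\<in>carrier (fobj F (restrict_scalars (self_alg K) T)). g (restrict_scalars (self_alg K) T) x)"

lemma functional_family_in_dual_set:
  assumes K: "cring K" and F: "K_module_functor K F"
    and closed: "\<And>S x. algebra K S \<Longrightarrow> x \<in> carrier (fobj F S) \<Longrightarrow> g S x \<in> carrier S"
    and add: "\<And>S x y. algebra K S \<Longrightarrow> x \<in> carrier (fobj F S) \<Longrightarrow> y \<in> carrier (fobj F S) \<Longrightarrow>
      g S (x \<oplus>\<^bsub>fobj F S\<^esub> y) = g S x \<oplus>\<^bsub>S\<^esub> g S y"
    and smult: "\<And>S s x. algebra K S \<Longrightarrow> s \<in> carrier S \<Longrightarrow> x \<in> carrier (fobj F S) \<Longrightarrow>
      g S (s \<odot>\<^bsub>fobj F S\<^esub> x) = s \<otimes>\<^bsub>S\<^esub> g S x"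
    and natural: "\<And>S T \<phi> x. algebra K S \<Longrightarrow> algebra K T \<Longrightarrow> \<phi> \<in> alg_hom K S T \<Longrightarrow>
      x \<in> carrier (fobj F S) \<Longrightarrow> g T (fmap F S T \<phi> x) = \<phi> (g S x)"
  shows "functional_family K F g \<in> dual_set F (self_alg K)"
proof -
  let ?R = "restrict_scalars (self_alg K)"
  have R: "algebra K (?R T)" if "algebra (self_alg K) T" for T
    using that algebra_restrict_scalars algebra_self_alg_iff[OF K] by blast
  have closures: "x \<oplus>\<^bsub>fobj F S\<^esub> y \<in> carrier (fobj F S)" "s \<odot>\<^bsub>fobj F S\<^esub> x \<in> carrier (fobj F S)"
    if "algebra K S" "s \<in> carrier S" "x \<in> carrier (fobj F S)" "y \<in> carrier (fobj F S)" for S s x y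
  proof -
    interpret module S "fobj F S" by (rule K_module_functorD(1)[OF F that(1)])
    show "x \<oplus>\<^bsub>fobj F S\<^esub> y \<in> carrier (fobj F S)" "s \<odot>\<^bsub>fobj F S\<^esub> x \<in> carrier (fobj F S)"
      using that by simp_all
  qed
  have one: "\<one>\<^bsub>S\<^esub> \<in> carrier S" if "algebra K S" for S :: "'a calg"
  proof -
    interpret algebra K S by fact
    show ?thesis by simp
  qed
  show ?thesis
    unfolding dual_set_def Let_def
  proof (intro CollectI conjI allI impI ballI)
    show "functional_family K F g \<in> (\<Pi>\<^sub>E T \<in> {T. algebra (self_alg K) T}. carrier (fobj F (?R T)) \<rightarrow>\<^sub>E carrier T)"
      unfolding functional_family_def
      by (intro restrict_PiE_iff[THEN iffD2] ballI) (use closed[OF R] in auto)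
  next
    fix T x y assume T: "algebra (self_alg K) T" and x: "x \<in> carrier (fobj F (?R T))" and y: "y \<in> carrier (fobj F (?R T))"
    show "functional_family K F g T (x \<oplus>\<^bsub>fobj F (?R T)\<^esub> y) =
        functional_family K F g T x \<oplus>\<^bsub>T\<^esub> functional_family K F g T y"
      using T x y add[OF R[OF T] x y] closures(1)[OF R[OF T] one[OF R[OF T]] x y]
      by (simp add: functional_family_def)
  next
    fix T t x assume T: "algebra (self_alg K) T" and t: "t \<in> carrier T" and x: "x \<in> carrier (fobj F (?R T))"
    show "functional_family K F g T (t \<odot>\<^bsub>fobj F (?R T)\<^esub> x) = t \<otimes>\<^bsub>T\<^esub> functional_family K F g T x"
      using T x t smult[OF R[OF T] _ x, of t] closures(2)[OF R[OF T] _ x x, of t]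
      by (simp add: functional_family_def)
  next
    fix T U \<phi> x assume T: "algebra (self_alg K) T" and U: "algebra (self_alg K) U"
      and \<phi>: "\<phi> \<in> alg_hom (self_alg K) T U" and x: "x \<in> carrier (fobj F (?R T))"
    note \<phi>' = alg_hom_restrict_scalars[OF K \<phi>]
    show "functional_family K F g U (fmap F (?R T) (?R U) \<phi> x) = \<phi> (functional_family K F g T x)"
      using T U x natural[OF R[OF T] R[OF U] \<phi>' x] K_module_functorD(2)[OF F R[OF T] R[OF U] \<phi>' x]
      by (simp add: functional_family_def)
  qed
qed

proposition D_proquasi_coherent_morphism_into_tensor_span:
  fixes K :: "'u ring"
  assumes K: "field K" and F: "D_proquasi_coherent K F" and V: "module K V" and W: "submodule W K V"
    and h: "K_module_morphism K F (quasi_coherent K V) h"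
    and hK: "\<And>a. a \<in> carrier (fobj F (self_alg K)) \<Longrightarrow> h (self_alg K) a \<in> tensor_span K V (self_alg K) W"
    and T: "algebra K T" and a: "a \<in> carrier (fobj F T)"
  shows "h T a \<in> tensor_span K V T W"
proof -
  let ?K = "self_alg K" and ?R = "restrict_scalars (self_alg K)"
  have Kc: "cring K" using K by (simp add: fieldE(1))
  have KK: "algebra K ?K" by (rule algebra_self_alg[OF Kc])
  have F': "K_module_functor K F" using F by (simp add: D_proquasi_coherent_def)
  note tp = tensor_productI[OF V]
  note hD = K_module_morphismD[OF h, unfolded fobj_quasi_coherent fmap_quasi_coherent]
  show ?thesis
  proof (rule tensor_product.tensor_span_separation[OF tp[OF T] K W hD(1)[OF T a]])
    fix l assume l: "linear_map K V ?K l" and lW: "\<And>w. w \<in> W \<Longrightarrow> l w = \<zero>\<^bsub>K\<^esub>"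
    define g where "g S x = functional_value l S (h S x)" for S x
    have g: "functional_family K F g \<in> dual_set F ?K"
    proof (rule functional_family_in_dual_set[OF Kc F'], goal_cases)
      case (1 S x)
      then show ?case unfolding g_def by (intro functional_value_closed[OF tp l] hD)
    next
      case (2 S x y)
      then show ?case by (simp add: g_def hD functional_value_add[OF tp l])
    next
      case (3 S s x)
      then show ?case by (simp add: g_def hD functional_value_smult[OF tp l])
    next
      case (4 S T \<phi> x)
      then show ?case by (simp add: g_def hD functional_value_natural[OF tp tp l])
    qed
    have z: "functional_family K F (\<lambda>S x. \<zero>\<^bsub>S\<^esub>) \<in> dual_set F ?K"
    proof (rule functional_family_in_dual_set[OF Kc F'], goal_cases)
      case (1 S x)
      interpret algebra K S by (rule 1)
      show ?case by simp
    next
      case (2 S x y)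
      interpret algebra K S by (rule 2)
      show ?case by simp
    next
      case (3 S s x)
      interpret algebra K S by (rule 3)
      show ?case using 3 by simp
    next
      case (4 S T \<phi> x)
      then show ?case by (simp add: ring_hom_zero_alg)
    qed
    \<comment> \<open>On \<open>s \<cdot> m\<close> with m a point of \<open>F(K)\<close>, the value is s times the image in S of \<open>l (h m) = 0\<close>.\<close>
    have vanish: "g S (from_points K F S x) = \<zero>\<^bsub>S\<^esub>"
      if S: "algebra K S" and x: "x \<in> carrier (tensor_module K (fobj F ?K) S)" for S x
    proof -
      have "module K (fobj F ?K)"
        using K_module_functorD(1)[OF F' KK] module_self_alg_iff[OF Kc] by blast
      then interpret A: tensor_product K "fobj F ?K" S by (rule tensor_productI[OF _ S])
      interpret FS: module S "fobj F S" by (rule K_module_functorD(1)[OF F' S])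
      note fp = from_points[OF Kc F' S]
      note fv = functional_value_add[OF tp[OF S] l] functional_value_smult[OF tp[OF S] l]
      show ?thesis
        using x
      proof (induction rule: A.tensor_induct)
        case (pure m s)
        have \<sigma>: "struct_map K S \<in> alg_hom K ?K S" by (rule struct_map_alg_hom[OF S])
        have "functional_value l ?K (h ?K m) = \<zero>\<^bsub>?K\<^esub>"
          by (rule tensor_product.functional_value_tensor_span[OF tp[OF KK] W l lW hK[OF pure(1)]])
        then have "functional_value l S (h S (fmap F ?K S (struct_map K S) m)) = \<zero>\<^bsub>S\<^esub>"
          using hD(4)[OF KK S \<sigma> pure(1)] ring_hom_zero_alg[OF KK S \<sigma>]
            functional_value_natural[OF tp[OF KK] tp[OF S] l \<sigma> hD(1)[OF KK pure(1)]] by simp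
        then show ?case
          using pure hD[OF S] K_module_functorD(2)[OF F' KK S \<sigma> pure(1)]
          by (simp add: fp g_def fv)
      next
        case (add x y)
        then show ?case
          using hD[OF S] by (simp add: fp g_def fv)
      qed
    qed
    let ?d = "dual_map (qc_of_points K F) (from_points K F) ?K"
    have "?d (functional_family K F g) = ?d (functional_family K F (\<lambda>S x. \<zero>\<^bsub>S\<^esub>))"
    proof -
      have R: "algebra K (?R T)" if "algebra ?K T" for T
        using that algebra_restrict_scalars algebra_self_alg_iff[OF Kc] by blast
      have "functional_family K F g T (from_points K F (?R T) x) =
          functional_family K F (\<lambda>S x. \<zero>\<^bsub>S\<^esub>) T (from_points K F (?R T) x)"
        if T: "algebra ?K T" and x: "x \<in> carrier (tensor_module K (fobj F ?K) (?R T))" for T x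
        using T vanish[OF R[OF T] x] from_points_closed[OF Kc F' R[OF T] x]
        by (simp add: functional_family_def)
      then show ?thesis
        unfolding dual_map_def by (intro restrict_ext) (simp add: qc_of_points_def)
    qed
    moreover have "inj_on ?d (dual_set F ?K)"
      using F KK by (simp add: D_proquasi_coherent_def)
    ultimately have eq: "functional_family K F g = functional_family K F (\<lambda>S x. \<zero>\<^bsub>S\<^esub>)"
      using g z by (simp add: inj_on_def)
    have T': "algebra ?K T" using T algebra_self_alg_iff[OF Kc] by blast
    have RT: "algebra K (?R T)" by (rule algebra_restrict_scalars[OF T])
    \<comment> \<open>The vanishing is known on the restriction of T; it is carried back along the identity map.\<close>
    let ?\<iota> = "\<lambda>t\<in>carrier T. t"
    have \<iota>: "?\<iota> \<in> alg_hom K T (?R T)" by (rule alg_hom_to_restrict_scalars[OF T])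
    have a': "fmap F T (?R T) ?\<iota> a \<in> carrier (fobj F (?R T))"
      by (rule K_module_functorD(2)[OF F' T RT \<iota> a])
    have "functional_value l T (h T a) = ?\<iota> (functional_value l T (h T a))"
      using functional_value_closed[OF tp[OF T] l hD(1)[OF T a]] by simp
    also have "\<dots> = g (?R T) (fmap F T (?R T) ?\<iota> a)"
      using functional_value_natural[OF tp[OF T] tp[OF RT] l \<iota> hD(1)[OF T a]] hD(4)[OF T RT \<iota> a]
      by (simp add: g_def)
    also have "\<dots> = \<zero>\<^bsub>T\<^esub>"
      using fun_cong[OF fun_cong[OF eq, of T], of "fmap F T (?R T) ?\<iota> a"] a' T'
      by (simp add: functional_family_def)
    finally show "functional_value l T (h T a) = \<zero>\<^bsub>T\<^esub>" .
  qed
qed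

section \<open>Actions of a functor of algebras\<close>

lemma underlying_module_simps [simp]:
  "carrier (fobj (underlying_module A) S) = carrier (aobj A S)"
  "ring.add (fobj (underlying_module A) S) = ring.add (aobj A S)"
  "smult (fobj (underlying_module A) S) = (\<lambda>s a. aunit A S s \<otimes>\<^bsub>aobj A S\<^esub> a)"
  "fmap (underlying_module A) = amap A"
  by (simp_all add: underlying_module_def ring.extend_def module.fields_def)

lemma left_moduleD:
  assumes "left_module R X act"
  shows "\<lbrakk>a \<in> carrier R; x \<in> carrier X\<rbrakk> \<Longrightarrow> act a x \<in> carrier X"
    and "\<lbrakk>a \<in> carrier R; b \<in> carrier R; x \<in> carrier X\<rbrakk> \<Longrightarrow> act (a \<oplus>\<^bsub>R\<^esub> b) x = act a x \<oplus>\<^bsub>X\<^esub> act b x"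
    and "\<lbrakk>a \<in> carrier R; x \<in> carrier X; y \<in> carrier X\<rbrakk> \<Longrightarrow> act a (x \<oplus>\<^bsub>X\<^esub> y) = act a x \<oplus>\<^bsub>X\<^esub> act a y"
    and "\<lbrakk>a \<in> carrier R; b \<in> carrier R; x \<in> carrier X\<rbrakk> \<Longrightarrow> act (a \<otimes>\<^bsub>R\<^esub> b) x = act a (act b x)"
  using assms unfolding left_module_def by blast+

lemma A_module_functorD:
  assumes "A_module_functor K A F act"
  shows "K_module_functor K F"
    and "algebra K S \<Longrightarrow> left_module (aobj A S) (fobj F S) (act S)"
    and "\<lbrakk>algebra K S; s \<in> carrier S; x \<in> carrier (fobj F S)\<rbrakk> \<Longrightarrow> act S (aunit A S s) x = s \<odot>\<^bsub>fobj F S\<^esub> x"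
    and "\<lbrakk>algebra K S; algebra K T; \<phi> \<in> alg_hom K S T; a \<in> carrier (aobj A S); x \<in> carrier (fobj F S)\<rbrakk> \<Longrightarrow>
      fmap F S T \<phi> (act S a x) = act T (amap A S T \<phi> a) (fmap F S T \<phi> x)"
  using assms unfolding A_module_functor_def by blast+

lemma K_algebra_functorD:
  assumes "K_algebra_functor K A" and "algebra K S"
  shows "ring (aobj A S)"
    and "s \<in> carrier S \<Longrightarrow> aunit A S s \<in> carrier (aobj A S)"
    and "\<lbrakk>s \<in> carrier S; a \<in> carrier (aobj A S)\<rbrakk> \<Longrightarrow>
      aunit A S s \<otimes>\<^bsub>aobj A S\<^esub> a = a \<otimes>\<^bsub>aobj A S\<^esub> aunit A S s"
  using assms ring_hom_closed[of "aunit A S" S "aobj A S" s] unfolding K_algebra_functor_def by blast+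

text \<open>
  S acts through \<open>\<A>(S)\<close> and is central there, so the action of \<open>\<A>(S)\<close> is S-linear in both
  arguments.
\<close>

lemma act_smult:
  assumes A: "K_algebra_functor K A" and F: "A_module_functor K A F act" and S: "algebra K S"
    and s: "s \<in> carrier S" and a: "a \<in> carrier (aobj A S)" and x: "x \<in> carrier (fobj F S)"
  shows "act S (aunit A S s \<otimes>\<^bsub>aobj A S\<^esub> a) x = s \<odot>\<^bsub>fobj F S\<^esub> act S a x"
    and "act S a (s \<odot>\<^bsub>fobj F S\<^esub> x) = s \<odot>\<^bsub>fobj F S\<^esub> act S a x"
proof -
  note L = left_moduleD[OF A_module_functorD(2)[OF F S]]
  note AD = K_algebra_functorD[OF A S]
  note u = A_module_functorD(3)[OF F S s]
  show 1: "act S (aunit A S s \<otimes>\<^bsub>aobj A S\<^esub> a) x = s \<odot>\<^bsub>fobj F S\<^esub> act S a x"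
    using L(4)[OF AD(2)[OF s] a x] u[OF L(1)[OF a x]] by simp
  show "act S a (s \<odot>\<^bsub>fobj F S\<^esub> x) = s \<odot>\<^bsub>fobj F S\<^esub> act S a x"
    using 1 L(4)[OF a AD(2)[OF s] x] u[OF x] AD(3)[OF s a] by simp
qed

text \<open>
  The elements \<open>y S\<close> form a global point of F, and the morphism \<open>a \<mapsto> a \<cdot> y\<close> is its orbit map.
  Naturality of the action together with that of y gives naturality in S.
\<close>

lemma K_module_morphism_orbit:
  assumes A: "K_algebra_functor K A" and F: "A_module_functor K A F act"
    and y: "\<And>S. algebra K S \<Longrightarrow> y S \<in> carrier (fobj F S)"
    and y_natural: "\<And>S T \<phi>. algebra K S \<Longrightarrow> algebra K T \<Longrightarrow> \<phi> \<in> alg_hom K S T \<Longrightarrow> fmap F S T \<phi> (y S) = y T"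
  shows "K_module_morphism K (underlying_module A) F (\<lambda>S a. act S a (y S))"
  unfolding K_module_morphism_def underlying_module_simps
  using y y_natural A_module_functorD(4)[OF F] act_smult(1)[OF A F]
    left_moduleD(1,2)[OF A_module_functorD(2)[OF F]]
  by auto

lemma K_module_morphism_compose:
  assumes "K_module_morphism K F G f" "K_module_morphism K G H g"
  shows "K_module_morphism K F H (\<lambda>S x. g S (f S x))"
  unfolding K_module_morphism_def
  using K_module_morphismD[OF assms(1)] K_module_morphismD[OF assms(2)] by simp

lemma fmap_zero:
  assumes F: "K_module_functor K F" and S: "algebra K S" "algebra K T" "\<phi> \<in> alg_hom K S T"
  shows "fmap F S T \<phi> \<zero>\<^bsub>fobj F S\<^esub> = \<zero>\<^bsub>fobj F T\<^esub>"
proof -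
  interpret FS: module S "fobj F S" by (rule K_module_functorD(1)[OF F S(1)])
  interpret FT: module T "fobj F T" by (rule K_module_functorD(1)[OF F S(2)])
  show ?thesis
    using K_module_functorD(3)[OF F S, of "\<zero>\<^bsub>fobj F S\<^esub>" "\<zero>\<^bsub>fobj F S\<^esub>"]
      K_module_functorD(2)[OF F S, of "\<zero>\<^bsub>fobj F S\<^esub>"] FT.add.r_cancel_one' by simp
qed

lemma K_module_morphism_diff:
  assumes G: "K_module_functor K G"
    and f: "K_module_morphism K F G f" and g: "K_module_morphism K F G g"
  shows "K_module_morphism K F G (\<lambda>S x. f S x \<ominus>\<^bsub>fobj G S\<^esub> g S x)"
proof -
  note fD = K_module_morphismD[OF f] and gD = K_module_morphismD[OF g]
  have "f S (x \<oplus>\<^bsub>fobj F S\<^esub> y) \<ominus>\<^bsub>fobj G S\<^esub> g S (x \<oplus>\<^bsub>fobj F S\<^esub> y) =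
      (f S x \<ominus>\<^bsub>fobj G S\<^esub> g S x) \<oplus>\<^bsub>fobj G S\<^esub> (f S y \<ominus>\<^bsub>fobj G S\<^esub> g S y)"
    "f S x \<ominus>\<^bsub>fobj G S\<^esub> g S x \<in> carrier (fobj G S)"
    if S: "algebra K S" and x: "x \<in> carrier (fobj F S)" and y: "y \<in> carrier (fobj F S)" for S x y
  proof -
    interpret GS: module S "fobj G S" by (rule K_module_functorD(1)[OF G S])
    have [simp]: "f S x \<in> carrier (fobj G S)" "g S x \<in> carrier (fobj G S)"
      "f S y \<in> carrier (fobj G S)" "g S y \<in> carrier (fobj G S)"
      using fD(1)[OF S] gD(1)[OF S] x y by auto
    show "f S (x \<oplus>\<^bsub>fobj F S\<^esub> y) \<ominus>\<^bsub>fobj G S\<^esub> g S (x \<oplus>\<^bsub>fobj F S\<^esub> y) =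
        (f S x \<ominus>\<^bsub>fobj G S\<^esub> g S x) \<oplus>\<^bsub>fobj G S\<^esub> (f S y \<ominus>\<^bsub>fobj G S\<^esub> g S y)"
      using S x y by (simp add: fD(2) gD(2) a_minus_def GS.minus_add GS.M.a_ac)
    show "f S x \<ominus>\<^bsub>fobj G S\<^esub> g S x \<in> carrier (fobj G S)" by simp
  qed
  moreover have "f S (s \<odot>\<^bsub>fobj F S\<^esub> x) \<ominus>\<^bsub>fobj G S\<^esub> g S (s \<odot>\<^bsub>fobj F S\<^esub> x) =
      s \<odot>\<^bsub>fobj G S\<^esub> (f S x \<ominus>\<^bsub>fobj G S\<^esub> g S x)"
    if S: "algebra K S" and s: "s \<in> carrier S" and x: "x \<in> carrier (fobj F S)" for S s x
  proof -
    interpret GS: module S "fobj G S" by (rule K_module_functorD(1)[OF G S])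
    show ?thesis
      using s fD(1)[OF S x] gD(1)[OF S x]
      by (simp add: fD(3)[OF S s x] gD(3)[OF S s x] a_minus_def GS.smult_r_distr GS.smult_r_minus)
  qed
  moreover have "f T (fmap F S T \<phi> x) \<ominus>\<^bsub>fobj G T\<^esub> g T (fmap F S T \<phi> x) =
      fmap G S T \<phi> (f S x \<ominus>\<^bsub>fobj G S\<^esub> g S x)"
    if S: "algebra K S" "algebra K T" "\<phi> \<in> alg_hom K S T" and x: "x \<in> carrier (fobj F S)" for S T \<phi> x
  proof -
    interpret GS: module S "fobj G S" by (rule K_module_functorD(1)[OF G S(1)])
    interpret GT: module T "fobj G T" by (rule K_module_functorD(1)[OF G S(2)])
    have fg: "f S x \<in> carrier (fobj G S)" "g S x \<in> carrier (fobj G S)"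
      using fD(1)[OF S(1) x] gD(1)[OF S(1) x] .
    note GD = K_module_functorD(2,3)[OF G S]
    have "fmap G S T \<phi> (\<ominus>\<^bsub>fobj G S\<^esub> g S x) = \<ominus>\<^bsub>fobj G T\<^esub> fmap G S T \<phi> (g S x)"
      using GD(2)[of "\<ominus>\<^bsub>fobj G S\<^esub> g S x" "g S x"] GD(1) fg(2) fmap_zero[OF G S]
      by (intro GT.minus_equality[symmetric]) (simp_all add: GS.M.l_neg)
    then show ?thesis
      using fg GD by (simp add: fD(4)[OF S(1,2,3) x] gD(4)[OF S(1,2,3) x] a_minus_def)
  qed
  ultimately show ?thesis
    unfolding K_module_morphism_def by blast
qed

lemma fmap_pure_one:
  assumes V: "module K V" and S: "algebra K S" "algebra K T" "\<phi> \<in> alg_hom K S T" and v: "v \<in> carrier V"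
  shows "fmap (quasi_coherent K V) S T \<phi> (pure_tensor K V S v \<one>\<^bsub>S\<^esub>) = pure_tensor K V T v \<one>\<^bsub>T\<^esub>"
proof -
  interpret algebra K S by (rule S)
  show ?thesis
    unfolding fmap_quasi_coherent
    using tensor_map_pure[OF tensor_productI[OF V S(1)] tensor_productI[OF V S(2)] linear_map_identity
        linear_map_alg_hom[OF S(3)] v, of "\<one>\<^bsub>S\<^esub>"] ring_hom_one[OF alg_homD(1)[OF S(3)]] by simp
qed

lemma pure_one_closed:
  assumes "module K V" "algebra K S" "v \<in> carrier V"
  shows "pure_tensor K V S v \<one>\<^bsub>S\<^esub> \<in> carrier (tensor_module K V S)"
proof -
  interpret tensor_product K V S using assms by (intro tensor_productI)
  show ?thesis using assms(3) by simp
qed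

lemma point_tensor_closed:
  "module K V \<Longrightarrow> v \<in> carrier V \<Longrightarrow> point_tensor K V v \<in> carrier (tensor_module K V (self_alg K))"
  using point_tensor_image by blast

lemma point_tensor_inverse:
  assumes "module K V" "x \<in> carrier (tensor_module K V (self_alg K))"
  shows "the_inv_into (carrier V) (point_tensor K V) x \<in> carrier V"
    and "point_tensor K V (the_inv_into (carrier V) (point_tensor K V) x) = x"
  using assms the_inv_into_into[OF inj_on_point_tensor[OF assms(1)], of x "carrier V"]
    f_the_inv_into_f[OF inj_on_point_tensor[OF assms(1)], of x]
  by (simp_all add: point_tensor_image)

lemma point_tensor_add:
  assumes "module K V" "v \<in> carrier V" "w \<in> carrier V"
  shows "point_tensor K V (v \<oplus>\<^bsub>V\<^esub> w) =
    point_tensor K V v \<oplus>\<^bsub>tensor_module K V (self_alg K)\<^esub> point_tensor K V w"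
proof -
  interpret tensor_product K V "self_alg K" by (rule tensor_product_self_alg[OF assms(1)])
  show ?thesis using assms(2,3) by (simp add: point_tensor_def pure_add_left)
qed

lemma point_action:
  assumes V: "module K V" and F: "A_module_functor K A (quasi_coherent K V) act"
    and a: "a \<in> carrier (aobj A (self_alg K))" and v: "v \<in> carrier V"
  shows point_action_closed: "point_action K V act a v \<in> carrier V"
    and point_tensor_point_action:
      "point_tensor K V (point_action K V act a v) = act (self_alg K) a (point_tensor K V v)"
proof -
  have "algebra K (self_alg K)" using V by (intro algebra_self_alg) (simp add: module_def)
  then have "act (self_alg K) a (point_tensor K V v) \<in> carrier (tensor_module K V (self_alg K))"
    using left_moduleD(1)[OF A_module_functorD(2)[OF F] a] point_tensor_closed[OF V v] by simp
  then show "point_action K V act a v \<in> carrier V"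
    "point_tensor K V (point_action K V act a v) = act (self_alg K) a (point_tensor K V v)"
    using point_tensor_inverse[OF V] by (simp_all add: point_action_def)
qed

lemma point_map:
  assumes V: "module K V" and W: "module K W"
    and f: "K_module_morphism K (quasi_coherent K V) (quasi_coherent K W) f" and v: "v \<in> carrier V"
  shows point_map_closed: "point_map K V W f v \<in> carrier W"
    and point_tensor_point_map: "point_tensor K W (point_map K V W f v) = f (self_alg K) (point_tensor K V v)"
proof -
  have "algebra K (self_alg K)" using V by (intro algebra_self_alg) (simp add: module_def)
  then have "f (self_alg K) (point_tensor K V v) \<in> carrier (tensor_module K W (self_alg K))"
    using K_module_morphismD(1)[OF f] point_tensor_closed[OF V v] by simp
  then show "point_map K V W f v \<in> carrier W"
    "point_tensor K W (point_map K V W f v) = f (self_alg K) (point_tensor K V v)"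
    using point_tensor_inverse[OF W] by (simp_all add: point_map_def)
qed

text \<open>
  Being a functor of K-modules with an injective inclusion holds for every subspace W, so the left
  side amounts to stability of \<open>W \<otimes> S\<close> under \<open>\<A>(S)\<close> for every S.
  Stability on the generators \<open>v \<otimes> 1\<close> comes from the orbit morphism of \<open>v \<otimes> 1\<close>, whose values at K lie in W.
\<close>

lemma A_submodule_functor_iff:
  fixes K :: "'u ring"
  assumes K: "field K" and A: "K_algebra_functor K A" and D: "D_proquasi_coherent K (underlying_module A)"
    and V: "module K V" and F: "A_module_functor K A (quasi_coherent K V) act" and W: "submodule W K V"
  shows "A_submodule_functor K A (quasi_coherent K V) act (quasi_coherent K (V\<lparr>carrier := W\<rparr>)) (qc_inclusion K V) \<longleftrightarrow>
    left_submodule (aobj A (self_alg K)) V (point_action K V act) W"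
proof -
  let ?K = "self_alg K" and ?W = "V\<lparr>carrier := W\<rparr>"
  have Kc: "cring K" using K by (simp add: fieldE(1))
  have KK: "algebra K ?K" by (rule algebra_self_alg[OF Kc])
  note tp = tensor_productI[OF V]
  note WV = subsetD[OF submodule_subset[OF W]]
  have "A_submodule_functor K A (quasi_coherent K V) act (quasi_coherent K ?W) (qc_inclusion K V) \<longleftrightarrow>
      (\<forall>S. algebra K S \<longrightarrow> (\<forall>a\<in>carrier (aobj A S). \<forall>x\<in>tensor_span K V S W. act S a x \<in> tensor_span K V S W))"
    unfolding A_submodule_functor_def left_submodule_def fobj_quasi_coherent tensor_span_def[symmetric]
    using K_module_functor_quasi_coherent[OF submodule.submodule_is_module[OF W V]]
      K_module_morphism_qc_inclusion[OF V W] tensor_product.inj_on_qc_inclusion[OF tp K W]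
      tensor_product.subgroup_tensor_span[OF tp W] by blast
  also have "\<dots> \<longleftrightarrow> (\<forall>a\<in>carrier (aobj A ?K). \<forall>v\<in>W. point_action K V act a v \<in> W)"
  proof (intro iffI allI impI ballI)
    fix a v assume stable: "\<forall>S. algebra K S \<longrightarrow> (\<forall>a\<in>carrier (aobj A S). \<forall>x\<in>tensor_span K V S W. act S a x \<in> tensor_span K V S W)"
      and a: "a \<in> carrier (aobj A ?K)" and v: "v \<in> W"
    have "act ?K a (point_tensor K V v) \<in> point_tensor K V ` W"
      using stable KK a v tensor_span_self_alg[OF V W] by blast
    then have "point_tensor K V (point_action K V act a v) \<in> point_tensor K V ` W"
      by (simp add: point_tensor_point_action[OF V F a WV[OF v]])
    then show "point_action K V act a v \<in> W"
      using inj_on_image_mem_iff[OF inj_on_point_tensor[OF V] point_action_closed[OF V F a WV[OF v]] submodule_subset[OF W]]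
      by blast
  next
    fix S a x assume stable: "\<forall>a\<in>carrier (aobj A ?K). \<forall>v\<in>W. point_action K V act a v \<in> W"
      and S: "algebra K S" and a: "a \<in> carrier (aobj A S)" and x: "x \<in> tensor_span K V S W"
    interpret X: tensor_product K V S by (rule tp[OF S])
    note L = left_moduleD[OF A_module_functorD(2)[OF F S], unfolded fobj_quasi_coherent]
    have gen: "act S a (pure_tensor K V S v \<one>\<^bsub>S\<^esub>) \<in> tensor_span K V S W" if v: "v \<in> W" for v
    proof -
      have mor: "K_module_morphism K (underlying_module A) (quasi_coherent K V)
          (\<lambda>S a. act S a (pure_tensor K V S v \<one>\<^bsub>S\<^esub>))"
        by (rule K_module_morphism_orbit[OF A F])
           (simp_all add: pure_one_closed[OF V _ WV[OF v]] fmap_pure_one[OF V _ _ _ WV[OF v]])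
      show ?thesis
      proof (rule D_proquasi_coherent_morphism_into_tensor_span[OF K D V W mor _ S])
        show "act ?K b (pure_tensor K V ?K v \<one>\<^bsub>?K\<^esub>) \<in> tensor_span K V ?K W"
          if "b \<in> carrier (fobj (underlying_module A) ?K)" for b
        proof -
          have b: "b \<in> carrier (aobj A ?K)" using that by simp
          have "act ?K b (point_tensor K V v) \<in> tensor_span K V ?K W"
            unfolding tensor_span_self_alg[OF V W] point_tensor_point_action[OF V F b WV[OF v], symmetric]
            using stable b v by blast
          then show ?thesis by (simp add: point_tensor_def)
        qed
      qed (simp add: a)
    qed
    show "act S a x \<in> tensor_span K V S W"
      using W x
    proof (induction rule: X.tensor_span_induct)
      case (pure w s)
      have "act S a (s \<odot>\<^bsub>X.X\<^esub> pure_tensor K V S w \<one>\<^bsub>S\<^esub>) = s \<odot>\<^bsub>X.X\<^esub> act S a (pure_tensor K V S w \<one>\<^bsub>S\<^esub>)"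
        using act_smult(2)[OF A F S pure(2) a, of "pure_tensor K V S w \<one>\<^bsub>S\<^esub>"] WV[OF pure(1)] by simp
      then show ?case
        using X.tensor_span_smult[OF W pure(2) gen[OF pure(1)]] X.pure_eq_smult[OF WV[OF pure(1)] pure(2)] by simp
    next
      case (add x y)
      then show ?case
        using L(3)[OF a, of x y] subsetD[OF X.tensor_span_subset[OF W]] X.tensor_span_add[OF W] by simp
    qed
  qed
  also have "\<dots> \<longleftrightarrow> left_submodule (aobj A ?K) V (point_action K V act) W"
    using submodule.axioms(1)[OF W] by (simp add: left_submodule_def)
  finally show ?thesis .
qed

text \<open>
  For fixed v, the defect \<open>a \<mapsto> f (a \<cdot> (v \<otimes> 1)) - a \<cdot> f (v \<otimes> 1)\<close> is a morphism from \<open>\<A>\<close> to \<open>\<W>\<close>.  If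
  \<open>f\<^sub>K\<close> is \<open>\<A>(K)\<close>-linear, its values at K lie in the zero subspace, hence all its values do.
\<close>

lemma A_module_morphism_iff:
  fixes K :: "'u ring"
  assumes K: "field K" and A: "K_algebra_functor K A" and D: "D_proquasi_coherent K (underlying_module A)"
    and V: "module K V" and W: "module K W"
    and F: "A_module_functor K A (quasi_coherent K V) actV" and G: "A_module_functor K A (quasi_coherent K W) actW"
    and f: "K_module_morphism K (quasi_coherent K V) (quasi_coherent K W) f"
  shows "A_module_morphism K A (quasi_coherent K V) actV (quasi_coherent K W) actW f \<longleftrightarrow>
    left_module_hom (aobj A (self_alg K)) V (point_action K V actV) W (point_action K W actW) (point_map K V W f)"
proof -
  let ?K = "self_alg K" and ?p = "point_map K V W f"
  interpret W: module K W by (rule W)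
  interpret V: module K V by (rule V)
  have Kc: "cring K" using K by (simp add: fieldE(1))
  have KK: "algebra K ?K" by (rule algebra_self_alg[OF Kc])
  note fD = K_module_morphismD[OF f, unfolded fobj_quasi_coherent]
  note pt = point_tensor_point_map[OF V W f] point_map_closed[OF V W f]
  note inj = inj_onD[OF inj_on_point_tensor[OF W]]
  have hom: "f S \<in> hom (add_monoid (tensor_module K V S)) (add_monoid (tensor_module K W S))" if "algebra K S" for S
    using fD(1,2)[OF that] by (auto simp: hom_def)
  have "?p (v \<oplus>\<^bsub>V\<^esub> w) = ?p v \<oplus>\<^bsub>W\<^esub> ?p w" if v: "v \<in> carrier V" and w: "w \<in> carrier V" for v w
  proof (rule inj)
    show "point_tensor K W (?p (v \<oplus>\<^bsub>V\<^esub> w)) = point_tensor K W (?p v \<oplus>\<^bsub>W\<^esub> ?p w)"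
      using v w by (simp add: pt point_tensor_add[OF W] point_tensor_add[OF V] fD(2)[OF KK] point_tensor_closed[OF V])
  qed (use v w pt in auto)
  then have phom: "?p \<in> hom (add_monoid V) (add_monoid W)"
    using pt by (auto simp: hom_def)
  have "A_module_morphism K A (quasi_coherent K V) actV (quasi_coherent K W) actW f \<longleftrightarrow>
      (\<forall>S. algebra K S \<longrightarrow> (\<forall>a\<in>carrier (aobj A S). \<forall>x\<in>carrier (tensor_module K V S). f S (actV S a x) = actW S a (f S x)))"
    unfolding A_module_morphism_def left_module_hom_def fobj_quasi_coherent using f hom by blast
  also have "\<dots> \<longleftrightarrow> (\<forall>a\<in>carrier (aobj A ?K). \<forall>v\<in>carrier V. ?p (point_action K V actV a v) = point_action K W actW a (?p v))"
  proof (intro iffI allI impI ballI)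
    fix a v assume lin: "\<forall>S. algebra K S \<longrightarrow> (\<forall>a\<in>carrier (aobj A S). \<forall>x\<in>carrier (tensor_module K V S). f S (actV S a x) = actW S a (f S x))"
      and a: "a \<in> carrier (aobj A ?K)" and v: "v \<in> carrier V"
    note pv = point_action_closed[OF V F a v] pt(2)[OF v]
    show "?p (point_action K V actV a v) = point_action K W actW a (?p v)"
    proof (rule inj)
      show "point_tensor K W (?p (point_action K V actV a v)) = point_tensor K W (point_action K W actW a (?p v))"
        using lin KK a v pv point_tensor_closed[OF V v]
        by (simp add: pt(1) point_tensor_point_action[OF V F] point_tensor_point_action[OF W G])
      show "?p (point_action K V actV a v) \<in> carrier W" by (rule pt(2)[OF pv(1)])
      show "point_action K W actW a (?p v) \<in> carrier W" by (rule point_action_closed[OF W G a pv(2)])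
    qed
  next
    fix S a x
    assume lin: "\<forall>a\<in>carrier (aobj A ?K). \<forall>v\<in>carrier V. ?p (point_action K V actV a v) = point_action K W actW a (?p v)"
      and S: "algebra K S" and a: "a \<in> carrier (aobj A S)" and x: "x \<in> carrier (tensor_module K V S)"
    interpret X: tensor_product K V S by (rule tensor_productI[OF V S])
    interpret Y: tensor_product K W S by (rule tensor_productI[OF W S])
    have zero: "submodule {\<zero>\<^bsub>W\<^esub>} K W"
      by (rule W.submoduleI) (auto simp: W.minus_equality)
    note LV = left_moduleD[OF A_module_functorD(2)[OF F S], unfolded fobj_quasi_coherent]
    note LW = left_moduleD[OF A_module_functorD(2)[OF G S], unfolded fobj_quasi_coherent]
    have gen: "f S (actV S a (pure_tensor K V S v \<one>\<^bsub>S\<^esub>)) = actW S a (f S (pure_tensor K V S v \<one>\<^bsub>S\<^esub>))"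
      if v: "v \<in> carrier V" for v
    proof -
      let ?v = "\<lambda>S. pure_tensor K V S v \<one>\<^bsub>S\<^esub>"
      have "K_module_morphism K (underlying_module A) (quasi_coherent K V) (\<lambda>S a. actV S a (?v S))"
        by (rule K_module_morphism_orbit[OF A F])
           (simp_all add: pure_one_closed[OF V _ v] fmap_pure_one[OF V _ _ _ v])
      then have m1: "K_module_morphism K (underlying_module A) (quasi_coherent K W) (\<lambda>S a. f S (actV S a (?v S)))"
        by (rule K_module_morphism_compose[OF _ f])
      have m2: "K_module_morphism K (underlying_module A) (quasi_coherent K W) (\<lambda>S a. actW S a (f S (?v S)))"
        by (rule K_module_morphism_orbit[OF A G])
           (simp_all add: fD(1) pure_one_closed[OF V _ v] fmap_pure_one[OF V _ _ _ v] fD(4)[symmetric])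
      note m = K_module_morphism_diff[OF A_module_functorD(1)[OF G] m1 m2, unfolded fobj_quasi_coherent]
      have "f S (actV S a (?v S)) \<ominus>\<^bsub>Y.X\<^esub> actW S a (f S (?v S)) \<in> tensor_span K W S {\<zero>\<^bsub>W\<^esub>}"
      proof (rule D_proquasi_coherent_morphism_into_tensor_span[OF K D W zero m _ S])
        fix b assume "b \<in> carrier (fobj (underlying_module A) ?K)"
        then have b: "b \<in> carrier (aobj A ?K)" by simp
        interpret Z: tensor_product K W ?K by (rule tensor_product_self_alg[OF W])
        have "f ?K (actV ?K b (point_tensor K V v)) = point_tensor K W (?p (point_action K V actV b v))"
          by (simp add: pt(1)[OF point_action_closed[OF V F b v]] point_tensor_point_action[OF V F b v])
        also have "\<dots> = point_tensor K W (point_action K W actW b (?p v))"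
          using lin b v by simp
        also have "\<dots> = actW ?K b (f ?K (point_tensor K V v))"
          by (simp add: point_tensor_point_action[OF W G b pt(2)[OF v]] pt(1)[OF v])
        finally have eq: "f ?K (actV ?K b (?v ?K)) = actW ?K b (f ?K (?v ?K))"
          by (simp add: point_tensor_def)
        have "actW ?K b (f ?K (?v ?K)) \<in> carrier Z.X"
          using left_moduleD(1)[OF A_module_functorD(2)[OF G KK] b, of "f ?K (?v ?K)"]
            fD(1)[OF KK pure_one_closed[OF V KK v]] by simp
        then have "f ?K (actV ?K b (?v ?K)) \<ominus>\<^bsub>Z.X\<^esub> actW ?K b (f ?K (?v ?K)) = \<zero>\<^bsub>Z.X\<^esub>"
          unfolding eq by (simp add: a_minus_def Z.X.r_neg)
        then show "f ?K (actV ?K b (?v ?K)) \<ominus>\<^bsub>Z.X\<^esub> actW ?K b (f ?K (?v ?K)) \<in> tensor_span K W ?K {\<zero>\<^bsub>W\<^esub>}"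
          using subgroup.one_closed[OF Z.subgroup_tensor_span[OF zero]] by simp
      qed (simp add: a)
      note diff = Y.tensor_span_zero[OF zero this]
      note cl = pure_one_closed[OF V S v]
      show ?thesis
        by (rule Y.eq_of_diff_zero[OF fD(1)[OF S LV(1)[OF a cl]] LW(1)[OF a fD(1)[OF S cl]] diff])
    qed
    show "f S (actV S a x) = actW S a (f S x)"
      using x
    proof (induction rule: X.tensor_induct)
      case (pure v s)
      have cl: "pure_tensor K V S v \<one>\<^bsub>S\<^esub> \<in> carrier X.X" using pure by simp
      show ?case
        unfolding X.pure_eq_smult[OF pure]
        using act_smult(2)[OF A F S pure(2) a, of "pure_tensor K V S v \<one>\<^bsub>S\<^esub>"]
          act_smult(2)[OF A G S pure(2) a, of "f S (pure_tensor K V S v \<one>\<^bsub>S\<^esub>)"]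
          fD(1,3)[OF S] cl pure gen[OF pure(1)] LV(1)[OF a cl] by simp
    next
      case (add x y)
      then show ?case
        using fD(1,2)[OF S] LV(1,3)[OF a] LW(3)[OF a] by simp
    qed
  qed
  also have "\<dots> \<longleftrightarrow> left_module_hom (aobj A ?K) V (point_action K V actV) W (point_action K W actW) ?p"
    using phom by (simp add: left_module_hom_def)
  finally show ?thesis .
qed

theorem proposition3p17:
  fixes K :: "'u ring" and A :: "('u, 'a) alg_functor"
    and M :: "('u, 'm) module" and N :: "('u, 'n) module"
    and actM :: "'u calg \<Rightarrow> 'a \<Rightarrow> ('m, 'u) tensor \<Rightarrow> ('m, 'u) tensor"
    and actN :: "'u calg \<Rightarrow> 'a \<Rightarrow> ('n, 'u) tensor \<Rightarrow> ('n, 'u) tensor"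
    and M' :: "'m set"
  assumes "field K"
    and "K_algebra_functor K A"
    and "D_proquasi_coherent K (underlying_module A)"
    and "module K M" and "module K N"
    and "A_module_functor K A (quasi_coherent K M) actM"
    and "A_module_functor K A (quasi_coherent K N) actN"
    and "submodule M' K M"
  shows "(A_submodule_functor K A (quasi_coherent K M) actM
            (quasi_coherent K (M\<lparr>carrier := M'\<rparr>)) (qc_inclusion K M) \<longleftrightarrow>
          left_submodule (aobj A (self_alg K)) M (point_action K M actM) M') \<and>
         (\<forall>f. K_module_morphism K (quasi_coherent K M) (quasi_coherent K N) f \<longrightarrow>
            (A_module_morphism K A (quasi_coherent K M) actM (quasi_coherent K N) actN f \<longleftrightarrow>
             left_module_hom (aobj A (self_alg K)) M (point_action K M actM)
               N (point_action K N actN) (point_map K M N f)))"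
  using A_submodule_functor_iff[OF assms(1-4,6,8)] A_module_morphism_iff[OF assms(1-7)] by blast

end
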